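(* For any integers $c,d\ge 2$, the strong product of the hypercubes $\mathbb{H}(c,2)$ and $\mathbb{H}(d,2)$ satisfies $$\mathrm{tww}(\mathbb{H}(c,2)\boxtimes\mathbb{H}(d,2))=2cd+2\cdot\min\{c-d,\ d-c\}-4.$$
   Context: All graphs are finite and simple (no loops or multiple edges). Twin-width. A trigraph $G$ has a vertex set $V(G)$, a set $E(G)$ of black edges and a set $R(G)$ of red edges, with $E(G)\cap R(G)=\emptyset$; a graph is a trigraph with no red edges. $N_G(v)$ is the set of vertices joined to $v$ by a black or red edge. A $d$-trigraph is a trigraph in which every vertex is incident with at most $d$ red edges. A contraction merges two distinct (not necessarily adjacent) vertices $u,v$ into a new vertex $w$: every vertex other than $u,v$ in $N_G(u)\triangle N_G(v)$ is joined to $w$ by a red edge; every $x\in N_G(u)\cap N_G(v)$ is joined to $w$ by a black edge if $ux,vx\in E(G)$ and by a red edge otherwise; all edges not incident with $u$ or $v$ are unchanged, and $u,v$ and their incident edges are removed. A $d$-sequence of an $n$-vertex graph $G$ is a sequence of $d$-trigraphs $G_n=G,G_{n-1},\dots,G_1=K_1$ with each $G_{i-1}$ obtained from $G_i$ by one contraction. The twin-width $\mathrm{tww}(G)$ is the least $d$ such that $G$ admits a $d$-sequence. Strong product. $G\boxtimes H$ has vertex set $V(G)\times V(H)$, and $(u,i)(v,j)$ is an edge iff [$u=v$ and $ij\in E(H)$] or [$i=j$ and $uv\in E(G)$] or [$uv\in E(G)$ and $ij\in E(H)$]. Hypercube. $\mathbb{H}(d,2)$ is the graph on $\{0,1\}^d$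 in which two vertices are adjacent iff they differ in exactly one coordinate. *)

theory Defs
  imports "HOL-Library.FuncSet"
begin

record 'a ugraph =
  verts :: "'a set"
  edges :: "'a set set"

text \<open>In a trigraph, \<open>edges\<close> are the black edges.\<close>

record 'a trigraph = "'a ugraph" +
  red :: "'a set set"

definition is_graph :: "('a, 'b) ugraph_scheme \<Rightarrow> bool" where
  "is_graph G \<longleftrightarrow> finite (verts G) \<and> (\<forall>e\<in>edges G. e \<subseteq> verts G \<and> card e = 2)"

definition is_trigraph :: "'a trigraph \<Rightarrow> bool" where
  "is_trigraph T \<longleftrightarrow> is_graph T \<and> (\<forall>e\<in>red T. e \<subseteq> verts T \<and> card e = 2) \<and>
     edges T \<inter> red T = {}"

definition trigraph_of :: "'a ugraph \<Rightarrow> 'a trigraph" where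
  "trigraph_of G = \<lparr>verts = verts G, edges = edges G, red = {}\<rparr>"

definition nbrs :: "'a trigraph \<Rightarrow> 'a \<Rightarrow> 'a set" where
  "nbrs T v = {x. {v, x} \<in> edges T \<union> red T}"

definition is_d_trigraph :: "nat \<Rightarrow> 'a trigraph \<Rightarrow> bool" where
  "is_d_trigraph d T \<longleftrightarrow> is_trigraph T \<and> (\<forall>v\<in>verts T. card {e\<in>red T. v \<in> e} \<le> d)"

definition contract :: "'a trigraph \<Rightarrow> 'a \<Rightarrow> 'a \<Rightarrow> 'a \<Rightarrow> 'a trigraph" where
  "contract T u v w =
    \<lparr>verts = insert w (verts T - {u, v}),
     edges = {e\<in>edges T. u \<notin> e \<and> v \<notin> e} \<union>
       {{w, x} | x. x \<in> nbrs T u \<inter> nbrs T v \<and> {u, x} \<in> edges T \<and> {v, x} \<in> edges T},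
     red = {e\<in>red T. u \<notin> e \<and> v \<notin> e} \<union>
       {{w, x} | x. x \<in> (nbrs T u - nbrs T v) \<union> (nbrs T v - nbrs T u) \<and> x \<noteq> u \<and> x \<noteq> v} \<union>
       {{w, x} | x. x \<in> nbrs T u \<inter> nbrs T v \<and> \<not> ({u, x} \<in> edges T \<and> {v, x} \<in> edges T)}\<rparr>"

text \<open>The merged vertex only has to be distinct from the vertices that remain: it may reuse the
  name of \<open>u\<close> or \<open>v\<close>, so that the notion is also adequate over a finite vertex type.\<close>

definition is_contraction :: "'a trigraph \<Rightarrow> 'a trigraph \<Rightarrow> bool" where
  "is_contraction T T' \<longleftrightarrow> (\<exists>u v w. u \<in> verts T \<and> v \<in> verts T \<and> u \<noteq> v \<and>
     w \<notin> verts T - {u, v} \<and> T' = contract T u v w)"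

definition is_d_sequence :: "nat \<Rightarrow> 'a ugraph \<Rightarrow> (nat \<Rightarrow> 'a trigraph) \<Rightarrow> bool" where
  "is_d_sequence d G S \<longleftrightarrow>
     S (card (verts G)) = trigraph_of G \<and>
     (\<exists>x. S 1 = \<lparr>verts = {x}, edges = {}, red = {}\<rparr>) \<and>
     (\<forall>i\<in>{1..card (verts G)}. is_d_trigraph d (S i)) \<and>
     (\<forall>i\<in>{2..card (verts G)}. is_contraction (S i) (S (i - 1)))"

text \<open>Every nonempty graph has a \<open>d\<close>-sequence for some \<open>d\<close>; on other arguments the value carries
  no meaning.\<close>

definition tww :: "'a ugraph \<Rightarrow> nat" where
  "tww G = (LEAST d. \<exists>S. is_d_sequence d G S)"

definition strong_product :: "'a ugraph \<Rightarrow> 'b ugraph \<Rightarrow> ('a \<times> 'b) ugraph"  (infixl \<open>\<boxtimes>\<close> 70) where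
  "G \<boxtimes> H =
    \<lparr>verts = verts G \<times> verts H,
     edges = {{(u, i), (v, j)} | u i v j.
       (u, i) \<in> verts G \<times> verts H \<and> (v, j) \<in> verts G \<times> verts H \<and>
       (u = v \<and> {i, j} \<in> edges H \<or> i = j \<and> {u, v} \<in> edges G \<or>
        {u, v} \<in> edges G \<and> {i, j} \<in> edges H)}\<rparr>"

definition hypercube :: "nat \<Rightarrow> (nat \<Rightarrow> nat) ugraph" where
  "hypercube d =
    \<lparr>verts = {..<d} \<rightarrow>\<^sub>E {0, 1},
     edges = {{x, y} | x y. x \<in> {..<d} \<rightarrow>\<^sub>E {0, 1} \<and> y \<in> {..<d} \<rightarrow>\<^sub>E {0, 1} \<and>
       card {i\<in>{..<d}. x i \<noteq> y i} = 1}\<rparr>"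

end

theory Submission imports Defs begin

text \<open>
  Write \<open>N[p]\<close> for the closed neighbourhood of a vertex \<open>p = (a, x)\<close>, so that
  \<open>N[(a, x)] = N[a] \<times> N[x]\<close> has \<open>(c + 1) (d + 1)\<close> elements. Closed neighbourhoods of distinct
  vertices of a hypercube share at most two vertices, hence already the first contraction creates
  a vertex of red degree at least \<open>2 (c - 1) (d + 1) - 2\<close> or \<open>2 (c + 1) (d - 1) - 2\<close>.

  For the upper bound, by symmetry, it suffices to contract with red degree at most
  \<open>2 (c - 1) (d + 1) - 2\<close>. Regard the first factor as the product of a 4-cycle (coordinates 0 and 1)
  with a smaller cube, and first contract each vertex with its antipode in the 4-cycle. The common
  neighbours of such a pair again form pairs, so they never cause red edges, whichever of the pairs
  have been contracted. The quotient has the adjacencies of the strong product of cubes of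
  dimensions \<open>c - 1\<close> and \<open>d\<close>. Now contract along one coordinate of the first factor at a time,
  then along those of the second; here counting all edges as red suffices, except that for
  \<open>c = 2\<close> one needs that the two vertices about to be identified are still joined by a black edge.
\<close>

section \<open>Quotient trigraphs and contraction sequences\<close>

lemma doubleton_mem_iff:
  assumes "\<And>x y. P x y \<longleftrightarrow> P y x"
  shows "{a, b} \<in> {{x, y} | x y. P x y} \<longleftrightarrow> P a b"
  using assms by (auto simp: doubleton_eq_iff)

definition adj :: "'a ugraph \<Rightarrow> 'a \<Rightarrow> 'a \<Rightarrow> bool" where
  "adj G x y \<longleftrightarrow> {x, y} \<in> edges G"

lemma adj_sym: "adj G x y \<longleftrightarrow> adj G y x"
  by (simp add: adj_def insert_commute)

text \<open>Membership of \<open>p\<close> and \<open>q\<close> in the image keeps the universal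
  clause from holding vacuously on an empty fibre, such as that of a name given up in a
  merge.\<close>

definition black :: "'a ugraph \<Rightarrow> ('a \<Rightarrow> 'b) \<Rightarrow> 'b \<Rightarrow> 'b \<Rightarrow> bool" where
  "black G r p q \<longleftrightarrow> p \<noteq> q \<and> p \<in> r ` verts G \<and> q \<in> r ` verts G \<and>
     (\<forall>x\<in>verts G. \<forall>y\<in>verts G. r x = p \<longrightarrow> r y = q \<longrightarrow> adj G x y)"

definition mixed :: "'a ugraph \<Rightarrow> ('a \<Rightarrow> 'b) \<Rightarrow> 'b \<Rightarrow> 'b \<Rightarrow> bool" where
  "mixed G r p q \<longleftrightarrow> p \<noteq> q \<and>
     (\<exists>x\<in>verts G. \<exists>y\<in>verts G. r x = p \<and> r y = q \<and> adj G x y) \<and>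
     (\<exists>x\<in>verts G. \<exists>y\<in>verts G. r x = p \<and> r y = q \<and> \<not> adj G x y)"

text \<open>The map \<open>r\<close> sends each vertex of \<open>G\<close> to the name of the vertex into which it has been contracted
  so far; contracting \<open>u\<close> and \<open>v\<close> then amounts to composing \<open>r\<close> with \<open>merge u v\<close>, which reuses the
  name \<open>u\<close>.\<close>

definition quotient_trigraph :: "'a ugraph \<Rightarrow> ('a \<Rightarrow> 'b) \<Rightarrow> 'b trigraph" where
  "quotient_trigraph G r =
    \<lparr>verts = r ` verts G, edges = {{p, q} | p q. black G r p q},
     red = {{p, q} | p q. mixed G r p q}\<rparr>"

definition merge :: "'b \<Rightarrow> 'b \<Rightarrow> 'b \<Rightarrow> 'b" where
  "merge u v p = (if p = v then u else p)"

lemma black_sym: "black G r p q \<longleftrightarrow> black G r q p"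
  unfolding black_def using adj_sym by metis

lemma mixed_sym: "mixed G r p q \<longleftrightarrow> mixed G r q p"
proof -
  have "mixed G r q p" if "mixed G r p q" for p q
    using that adj_sym[of G] unfolding mixed_def by blast
  then show ?thesis by blast
qed

lemma verts_quotient [simp]: "verts (quotient_trigraph G r) = r ` verts G"
  by (simp add: quotient_trigraph_def)

lemma edges_quotient_iff [simp]: "{p, q} \<in> edges (quotient_trigraph G r) \<longleftrightarrow> black G r p q"
  by (simp only: quotient_trigraph_def ugraph.select_convs doubleton_mem_iff[OF black_sym])

lemma red_quotient_iff [simp]: "{p, q} \<in> red (quotient_trigraph G r) \<longleftrightarrow> mixed G r p q"
  by (simp only: quotient_trigraph_def trigraph.select_convs doubleton_mem_iff[OF mixed_sym])

lemma nbrs_quotient: "nbrs (quotient_trigraph G r) p = {q. black G r p q \<or> mixed G r p q}"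
  by (simp add: nbrs_def)

text \<open>Black and red edges alike need one edge of \<open>G\<close> between the two fibres; a
  non-adjacent pair only decides the colour.\<close>

lemma nbr_quotient_iff:
  "black G r p q \<or> mixed G r p q \<longleftrightarrow>
     p \<noteq> q \<and> (\<exists>x\<in>verts G. \<exists>y\<in>verts G. r x = p \<and> r y = q \<and> adj G x y)"
  (is "_ \<longleftrightarrow> _ \<and> ?E")
proof
  assume "black G r p q \<or> mixed G r p q"
  then show "p \<noteq> q \<and> ?E"
    by (fastforce simp: black_def mixed_def)
next
  assume r: "p \<noteq> q \<and> ?E"
  show "black G r p q \<or> mixed G r p q"
  proof (cases "\<forall>x\<in>verts G. \<forall>y\<in>verts G. r x = p \<longrightarrow> r y = q \<longrightarrow> adj G x y")
    case True
    then show ?thesis using r by (auto simp: black_def)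
  next
    case False
    then show ?thesis using r by (auto simp: mixed_def)
  qed
qed

lemma merge_eq_iff:
  assumes "u \<noteq> v"
  shows "merge u v p = u \<longleftrightarrow> p = u \<or> p = v"
    and "q \<noteq> u \<Longrightarrow> merge u v p = q \<longleftrightarrow> q \<noteq> v \<and> p = q"
  using assms by (auto simp: merge_def)

lemma image_merge:
  assumes "u \<noteq> v" "u \<in> r ` verts G"
  shows "(merge u v \<circ> r) ` verts G = r ` verts G - {v}"
proof -
  have "merge u v ` A = A - {v}" if "u \<in> A" for A
    using assms(1) that by (auto simp: merge_def image_iff)
  from this[OF assms(2)] show ?thesis by (simp add: image_comp)
qed

text \<open>A merge empties the fibre of \<open>v\<close> and leaves all fibres other than those of
  \<open>u\<close> and \<open>v\<close> unchanged.\<close>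

lemma black_merge_other:
  assumes "p \<noteq> u" "q \<noteq> u" "u \<noteq> v" "u \<in> r ` verts G"
  shows "black G (merge u v \<circ> r) p q \<longleftrightarrow> p \<noteq> v \<and> q \<noteq> v \<and> black G r p q"
  unfolding black_def image_merge[OF assms(3,4)] comp_apply
    merge_eq_iff(2)[OF assms(3) assms(1)] merge_eq_iff(2)[OF assms(3) assms(2)]
  by blast

lemma mixed_merge_other:
  assumes "p \<noteq> u" "q \<noteq> u" "u \<noteq> v"
  shows "mixed G (merge u v \<circ> r) p q \<longleftrightarrow> p \<noteq> v \<and> q \<noteq> v \<and> mixed G r p q"
  unfolding mixed_def comp_apply
    merge_eq_iff(2)[OF assms(3) assms(1)] merge_eq_iff(2)[OF assms(3) assms(2)]
  by blast

lemma black_merge: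
  assumes "u \<noteq> v" "u \<in> r ` verts G" "v \<in> r ` verts G"
  shows "black G (merge u v \<circ> r) u q \<longleftrightarrow> black G r u q \<and> black G r v q"
proof -
  have "black G (merge u v \<circ> r) u q \<longleftrightarrow> black G r u q \<and> black G r v q" if "q \<noteq> u"
    using assms that unfolding black_def image_merge[OF assms(1,2)] comp_apply
      merge_eq_iff(1)[OF assms(1)] merge_eq_iff(2)[OF assms(1) that]
    by blast
  then show ?thesis by (cases "q = u") (simp_all add: black_def)
qed

text \<open>The new fibre of \<open>u\<close> is the union of the old fibres of \<open>u\<close> and
  \<open>v\<close>, so edges and non-edges towards \<open>q\<close> are pooled. The right-hand side
  has the shape of the red edges in \<open>contract\<close>.\<close>

lemma mixed_merge:
  assumes "u \<noteq> v" "u \<in> r ` verts G" "v \<in> r ` verts G"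
  defines "N \<equiv> nbrs (quotient_trigraph G r)"
  shows "mixed G (merge u v \<circ> r) u q \<longleftrightarrow>
    (q \<in> (N u - N v) \<union> (N v - N u) \<and> q \<noteq> u \<and> q \<noteq> v) \<or>
    (q \<in> N u \<inter> N v \<and> \<not> (black G r u q \<and> black G r v q))"
proof (cases "q = u \<or> q = v")
  \<comment> \<open>For these two values both sides are false: there are no loops, and the fibre of
    \<open>v\<close> has become empty.\<close>
  case True
  have "\<not> mixed G (merge u v \<circ> r) u q"
    using True merge_eq_iff(2)[OF assms(1), of v] assms(1) by (auto simp: mixed_def)
  moreover have "u \<notin> N u" "v \<notin> N v"
    by (simp_all add: N_def nbrs_quotient black_def mixed_def)
  ultimately show ?thesis using True by blast
next
  case False
  then have q_neq: "q \<noteq> u" by blast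
  have q: "q \<in> r ` verts G" if "q \<in> N u \<or> q \<in> N v"
    using that by (auto simp: N_def nbrs_quotient nbr_quotient_iff)
  have 1: "(\<exists>x\<in>verts G. \<exists>y\<in>verts G. (merge u v \<circ> r) x = u \<and> (merge u v \<circ> r) y = q \<and> adj G x y)
     \<longleftrightarrow> q \<in> N u \<or> q \<in> N v"
    using False unfolding N_def nbrs_quotient nbr_quotient_iff comp_apply mem_Collect_eq
      merge_eq_iff(1)[OF assms(1)] merge_eq_iff(2)[OF assms(1) q_neq] by blast
  have 2: "(\<exists>x\<in>verts G. \<exists>y\<in>verts G. (merge u v \<circ> r) x = u \<and> (merge u v \<circ> r) y = q \<and> \<not> adj G x y)
     \<longleftrightarrow> \<not> (black G r u q \<and> black G r v q)" if "q \<in> r ` verts G"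
    using False assms(2,3) that unfolding black_def comp_apply
      merge_eq_iff(1)[OF assms(1)] merge_eq_iff(2)[OF assms(1) q_neq] by blast
  have 3: "mixed G (merge u v \<circ> r) u q \<longleftrightarrow>
     (q \<in> N u \<or> q \<in> N v) \<and> \<not> (black G r u q \<and> black G r v q)"
    unfolding mixed_def 1 using False 2 q by blast
  have "q \<in> N u" if "black G r u q"
    using that by (simp add: N_def nbrs_quotient)
  moreover have "q \<in> N v" if "black G r v q"
    using that by (simp add: N_def nbrs_quotient)
  ultimately show ?thesis using 3 False by blast
qed

text \<open>Iterated contractions of \<open>G\<close> can thus be described by the fibres of one
  map. Edges at the merged vertex and edges avoiding it are compared separately.\<close>

lemma contract_quotient:
  assumes "u \<noteq> v" "u \<in> r ` verts G" "v \<in> r ` verts G"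
  shows "contract (quotient_trigraph G r) u v u = quotient_trigraph G (merge u v \<circ> r)"
proof -
  let ?Q = "quotient_trigraph G r" and ?Q' = "quotient_trigraph G (merge u v \<circ> r)"
  let ?C = "contract ?Q u v u"
  have V: "verts ?C = verts ?Q'"
    using assms unfolding verts_quotient image_merge[OF assms(1,2)] by (auto simp: contract_def)
  have e: "\<exists>p q. e = {p, q}" if "e \<in> edges ?C \<union> edges ?Q' \<union> red ?C \<union> red ?Q'" for e
    using that by (auto simp: contract_def quotient_trigraph_def)
  have d: "{u, q} = {u, x} \<longleftrightarrow> x = q" for q x
    by (auto simp: doubleton_eq_iff)
  have o: "\<nexists>x. {p, q} = {u, x} \<and> P x" if "p \<noteq> u" "q \<noteq> u" for p q and P :: "'a \<Rightarrow> bool"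
    using that by (auto simp: doubleton_eq_iff)
  have E1: "{u, q} \<in> edges ?C \<longleftrightarrow> {u, q} \<in> edges ?Q'" for q
    by (simp add: contract_def d black_merge[OF assms] nbrs_quotient) blast
  have R1: "{u, q} \<in> red ?C \<longleftrightarrow> {u, q} \<in> red ?Q'" for q
    by (simp add: contract_def d mixed_merge[OF assms])
  have E2: "{p, q} \<in> edges ?C \<longleftrightarrow> {p, q} \<in> edges ?Q'" if "p \<noteq> u" "q \<noteq> u" for p q
    using that by (simp add: contract_def o black_merge_other[OF that assms(1,2)]) blast
  have R2: "{p, q} \<in> red ?C \<longleftrightarrow> {p, q} \<in> red ?Q'" if "p \<noteq> u" "q \<noteq> u" for p q
    using that by (simp add: contract_def o mixed_merge_other[OF that assms(1)]) blast
  have "{p, q} \<in> edges ?C \<longleftrightarrow> {p, q} \<in> edges ?Q'" for p q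
    using E1[of q] E1[of p, unfolded insert_commute[of u p]] E2[of p q] by blast
  then have "edges ?C = edges ?Q'" using e by blast
  moreover have "{p, q} \<in> red ?C \<longleftrightarrow> {p, q} \<in> red ?Q'" for p q
    using R1[of q] R1[of p, unfolded insert_commute[of u p]] R2[of p q] by blast
  then have "red ?C = red ?Q'" using e by blast
  ultimately show ?thesis using V by (intro trigraph.equality) simp_all
qed

section \<open>Contracting a quotient down to a single vertex\<close>

inductive collapses :: "nat \<Rightarrow> 'a ugraph \<Rightarrow> ('a \<Rightarrow> 'b) \<Rightarrow> bool" for k G where
  single: "r ` verts G = {p} \<Longrightarrow> collapses k G r"
| merge: "\<lbrakk>\<And>p. p \<in> r ` verts G \<Longrightarrow> card {q. mixed G r p q} \<le> k;
    u \<in> r ` verts G; v \<in> r ` verts G; u \<noteq> v; collapses k G (merge u v \<circ> r)\<rbrakk>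
   \<Longrightarrow> collapses k G r"

lemma is_trigraph_quotient:
  assumes "finite (verts G)"
  shows "is_trigraph (quotient_trigraph G r)"
proof -
  have "edges (quotient_trigraph G r) \<inter> red (quotient_trigraph G r) = {}"
  proof -
    have False if "black G r p q" "mixed G r p q" for p q
      using that by (auto simp: black_def mixed_def)
    moreover have "\<exists>p q. e = {p, q}" if "e \<in> edges (quotient_trigraph G r)" for e
      using that by (auto simp: quotient_trigraph_def)
    ultimately show ?thesis
      by (metis disjoint_iff edges_quotient_iff red_quotient_iff)
  qed
  then show ?thesis
    using assms unfolding is_trigraph_def is_graph_def
    by (auto simp: quotient_trigraph_def black_def mixed_def)
qed

lemma is_d_trigraph_quotient:
  assumes "finite (verts G)" "\<And>p. p \<in> r ` verts G \<Longrightarrow> card {q. mixed G r p q} \<le> k"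
  shows "is_d_trigraph k (quotient_trigraph G r)"
proof -
  have "card {e \<in> red (quotient_trigraph G r). p \<in> e} \<le> k" if p: "p \<in> r ` verts G" for p
  proof -
    have "finite {q. mixed G r p q}"
      by (rule finite_subset[of _ "r ` verts G"]) (use assms(1) in \<open>auto simp: mixed_def\<close>)
    moreover have "{e \<in> red (quotient_trigraph G r). p \<in> e} \<subseteq> (\<lambda>q. {p, q}) ` {q. mixed G r p q}"
      using mixed_sym[of G r] by (auto simp: quotient_trigraph_def insert_commute)
    ultimately have "card {e \<in> red (quotient_trigraph G r). p \<in> e} \<le> card {q. mixed G r p q}"
      using surj_card_le by blast
    then show ?thesis using assms(2)[OF p] by simp
  qed
  then show ?thesis
    using is_trigraph_quotient[OF assms(1)] by (simp add: is_d_trigraph_def)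
qed

text \<open>\<open>collapses\<close> records contractions without counting them. The number of
  remaining vertices recovers the index, so each merge adds one trigraph at the top of the
  sequence.\<close>

lemma collapses_sequence:
  assumes "collapses k G r" "finite (verts G)"
  shows "\<exists>S. S (card (r ` verts G)) = quotient_trigraph G r \<and>
     (\<exists>x. S 1 = \<lparr>verts = {x}, edges = {}, red = {}\<rparr>) \<and>
     (\<forall>i\<in>{1..card (r ` verts G)}. is_d_trigraph k (S i)) \<and>
     (\<forall>i\<in>{2..card (r ` verts G)}. is_contraction (S i) (S (i - 1)))"
  using assms(1)
proof induction
  case (single r p)
  have r: "r x = p" if "x \<in> verts G" for x using single that by blast
  have "\<not> black G r x y" "\<not> mixed G r x y" for x y
    using r by (auto simp: black_def mixed_def)
  then have "quotient_trigraph G r = \<lparr>verts = {p}, edges = {}, red = {}\<rparr>"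
    using single by (simp add: quotient_trigraph_def)
  moreover have "is_d_trigraph k (quotient_trigraph G r)"
    using \<open>\<And>x y. \<not> mixed G r x y\<close> by (intro is_d_trigraph_quotient[OF assms(2)]) simp
  ultimately show ?case
    using single by (intro exI[of _ "\<lambda>_. quotient_trigraph G r"]) auto
next
  case (merge r u v)
  let ?n = "card (r ` verts G)" and ?r = "merge u v \<circ> r"
  obtain S where S: "S (card (?r ` verts G)) = quotient_trigraph G ?r"
    "\<exists>x. S 1 = \<lparr>verts = {x}, edges = {}, red = {}\<rparr>"
    "\<forall>i\<in>{1..card (?r ` verts G)}. is_d_trigraph k (S i)"
    "\<forall>i\<in>{2..card (?r ` verts G)}. is_contraction (S i) (S (i - 1))"
    using merge.IH by blast
  have im: "?r ` verts G = r ` verts G - {v}"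
    using merge.hyps(2-4) by (auto simp: merge_def image_iff)
  have fin: "finite (r ` verts G)" using assms(2) by simp
  have n: "?n = Suc (card (?r ` verts G))"
    unfolding im using fin merge.hyps(3) by (metis card.remove)
  \<comment> \<open>The new index \<open>?n\<close> is therefore at least 2, and writing to it
    leaves the final trigraph \<open>S 1\<close> in place.\<close>
  have pos: "card (?r ` verts G) \<ge> 1"
    unfolding im using fin merge.hyps(2,4) by (simp add: card_gt_0_iff Suc_le_eq) blast
  define S' where "S' = S(?n := quotient_trigraph G r)"
  have "is_contraction (quotient_trigraph G r) (quotient_trigraph G ?r)"
    unfolding is_contraction_def
    using contract_quotient[of u v r G] merge.hyps(2-4)
    by (metis Diff_iff insertCI verts_quotient)
  then have "\<forall>i\<in>{2..?n}. is_contraction (S' i) (S' (i - 1))"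
    using S(1,4) n by (auto simp: S'_def le_Suc_eq)
  moreover have "\<forall>i\<in>{1..?n}. is_d_trigraph k (S' i)"
    using S(3) n is_d_trigraph_quotient[OF assms(2), of r k] merge.hyps(1)
    by (auto simp: S'_def le_Suc_eq)
  moreover have "S' ?n = quotient_trigraph G r" "S' 1 = S 1"
    using n pos by (auto simp: S'_def)
  ultimately show ?case using S(2) by metis
qed

text \<open>With singleton fibres no pair is mixed. A bijection rather than the identity is allowed
  so that contractions found for one graph serve an isomorphic one.\<close>

lemma trigraph_of_eq_quotient:
  assumes "bij_betw f (verts G) (verts H)" "is_graph H"
    and "\<And>x y. x \<in> verts G \<Longrightarrow> y \<in> verts G \<Longrightarrow> adj H (f x) (f y) \<longleftrightarrow> adj G x y"
  shows "quotient_trigraph G f = trigraph_of H"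
proof -
  have V: "f ` verts G = verts H" and inj: "inj_on f (verts G)"
    using assms(1) by (auto simp: bij_betw_def)
  have b: "black G f p q \<longleftrightarrow> adj H p q \<and> p \<noteq> q" if "p \<in> verts H" "q \<in> verts H" for p q
    using that assms(3) inj unfolding black_def V[symmetric] by (auto simp: inj_on_eq_iff)
  have "\<not> mixed G f p q" for p q
    using inj by (auto simp: mixed_def inj_on_eq_iff)
  moreover have "{{p, q} | p q. black G f p q} = edges H"
  proof (intro set_eqI iffI)
    fix e assume "e \<in> {{p, q} | p q. black G f p q}"
    then obtain p q where "e = {p, q}" "black G f p q" by blast
    then show "e \<in> edges H" using b V by (metis adj_def black_def)
  next
    fix e assume e: "e \<in> edges H"
    then obtain p q where pq: "e = {p, q}" "p \<noteq> q"
      using assms(2) by (metis card_2_iff is_graph_def)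
    then have "black G f p q"
      using b[of p q] e assms(2) by (auto simp: adj_def is_graph_def)
    then show "e \<in> {{p, q} | p q. black G f p q}" using pq by blast
  qed
  ultimately show ?thesis
    by (simp add: quotient_trigraph_def trigraph_of_def V)
qed

lemma is_d_sequence_exists:
  assumes "collapses k G f" "is_graph G" "bij_betw f (verts G) (verts H)" "is_graph H"
    and "\<And>x y. x \<in> verts G \<Longrightarrow> y \<in> verts G \<Longrightarrow> adj H (f x) (f y) \<longleftrightarrow> adj G x y"
  shows "\<exists>S. is_d_sequence k H S"
  using collapses_sequence[OF assms(1)] assms(2,3) trigraph_of_eq_quotient[OF assms(3-5)]
  by (simp add: is_d_sequence_def is_graph_def bij_betw_def)

lemma tww_le:
  assumes "collapses k G f" "is_graph G" "bij_betw f (verts G) (verts H)" "is_graph H"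
    and "\<And>x y. x \<in> verts G \<Longrightarrow> y \<in> verts G \<Longrightarrow> adj H (f x) (f y) \<longleftrightarrow> adj G x y"
  shows "tww H \<le> k"
  unfolding tww_def by (rule Least_le, rule is_d_sequence_exists) (fact assms)+

lemma collapses_cong:
  assumes "collapses k G r" "\<And>x. x \<in> verts G \<Longrightarrow> r' x = r x"
  shows "collapses k G r'"
  using assms
proof (induction arbitrary: r')
  case (single r p)
  then have "r' ` verts G = {p}" by (metis image_cong)
  then show ?case by (rule collapses.single)
next
  case (merge r u v)
  have im: "r' ` verts G = r ` verts G" using merge.prems by (metis image_cong)
  have "mixed G r' = mixed G r"
    using merge.prems by (fastforce simp: mixed_def fun_eq_iff)
  moreover have "collapses k G (merge u v \<circ> r')"
    by (rule merge.IH) (simp add: merge.prems)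
  ultimately show ?case
    using merge.hyps by (intro collapses.merge[of r' G k u v]) (simp_all add: im)
qed

text \<open>An injective renaming of the names keeps the fibres and hence the red degrees. It serves
  to exchange the factors of a strong product.\<close>

lemma collapses_relabel:
  assumes "collapses k G r" "finite (verts G)" "inj_on f (r ` verts G)"
  shows "collapses k G (f \<circ> r)"
  using assms(1,3)
proof induction
  case (single r p)
  then have "(f \<circ> r) ` verts G = {f p}" by (metis image_comp image_empty image_insert)
  then show ?case by (rule collapses.single)
next
  case (merge r u v)
  have sub: "(merge u v \<circ> r) ` verts G \<subseteq> r ` verts G"
    using merge.hyps by (auto simp: merge_def)
  have "collapses k G (f \<circ> (merge u v \<circ> r))"
    using merge.IH inj_on_subset[OF merge.prems sub] by blast
  then have "collapses k G (merge (f u) (f v) \<circ> (f \<circ> r))"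
    by (rule collapses_cong) (use merge.hyps merge.prems in \<open>auto simp: merge_def inj_on_eq_iff\<close>)
  moreover have "card {q. mixed G (f \<circ> r) (f p) q} \<le> k" if "p \<in> r ` verts G" for p
  proof -
    have "{q. mixed G (f \<circ> r) (f p) q} \<subseteq> f ` {q. mixed G r p q}"
    proof
      fix q assume "q \<in> {q. mixed G (f \<circ> r) (f p) q}"
      then obtain x y x' y' where q: "f p \<noteq> q" "x \<in> verts G" "y \<in> verts G" "x' \<in> verts G" "y' \<in> verts G"
        "f (r x) = f p" "f (r y) = q" "adj G x y"
        "f (r x') = f p" "f (r y') = q" "\<not> adj G x' y'"
        by (auto simp: mixed_def)
      then have "r x = p" "r x' = p" "r y' = r y"
        using merge.prems that by (auto simp: inj_on_eq_iff)
      then have "mixed G r p (r y)" using q unfolding mixed_def by blast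
      then show "q \<in> f ` {q. mixed G r p q}" using q by blast
    qed
    moreover have "finite {q. mixed G r p q}"
      by (rule finite_subset[of _ "r ` verts G"]) (use assms(2) in \<open>auto simp: mixed_def\<close>)
    ultimately have "card {q. mixed G (f \<circ> r) (f p) q} \<le> card {q. mixed G r p q}"
      using surj_card_le by blast
    then show ?thesis using merge.hyps(1)[OF that] by simp
  qed
  ultimately show ?case
    using merge.hyps(2-4) merge.prems
    by (intro collapses.merge[of "f \<circ> r" G k "f u" "f v"]) (auto simp: inj_on_eq_iff)
qed

text \<open>The vertices in \<open>M\<close> are merged into their images one at a time, in any order; \<open>S\<close> is the set of those
  already merged.\<close>

lemma collapses_stage:
  fixes r :: "'a \<Rightarrow> 'b"
  assumes "finite (verts G)" "M \<subseteq> r ` verts G"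
    and f: "\<And>p. p \<in> M \<Longrightarrow> f p \<in> r ` verts G - M"
    and deg: "\<And>S p. \<lbrakk>S \<subseteq> M; p \<in> r ` verts G - S\<rbrakk> \<Longrightarrow>
       card {q. mixed G (\<lambda>x. if r x \<in> S then f (r x) else r x) p q} \<le> k"
    and last: "collapses k G (\<lambda>x. if r x \<in> M then f (r x) else r x)"
  shows "collapses k G r"
proof -
  define rs where "rs S x = (if r x \<in> S then f (r x) else r x)" for S x
  have "finite M" using assms(1,2) finite_subset by blast
  \<comment> \<open>\<open>T\<close> holds the vertices still to be merged: the induction starts
    from the finished stage \<open>T = {}\<close> and undoes one merge at a time.\<close>
  have "collapses k G (rs (M - T))" if "finite T" "T \<subseteq> M" for T
    using that
  proof induction
    case empty
    then show ?case using last by (simp add: rs_def[abs_def])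
  next
    case (insert v T)
    let ?S = "M - insert v T"
    have im: "rs ?S ` verts G = r ` verts G - ?S"
    proof
      show "rs ?S ` verts G \<subseteq> r ` verts G - ?S"
        using f by (auto simp: rs_def)
      show "r ` verts G - ?S \<subseteq> rs ?S ` verts G"
        by (auto simp: rs_def image_iff intro!: bexI)
    qed
    \<comment> \<open>No value of \<open>f\<close> lies in \<open>M\<close>, so exactly the fibre of
      \<open>v\<close> is renamed.\<close>
    have "merge (f v) v \<circ> rs ?S = rs (M - T)"
    proof
      fix x
      have "v \<in> M" "v \<notin> T" using insert by auto
      moreover have "f (r x) \<noteq> v" if "r x \<in> M" using f[OF that] \<open>v \<in> M\<close> by auto
      ultimately show "(merge (f v) v \<circ> rs ?S) x = rs (M - T) x"
        by (auto simp: merge_def rs_def)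
    qed
    then have coll: "collapses k G (merge (f v) v \<circ> rs ?S)" using insert by auto
    have uv: "f v \<in> rs ?S ` verts G" "v \<in> rs ?S ` verts G" "f v \<noteq> v"
      unfolding im using f[of v] insert.prems assms(2) by auto
    have "card {q. mixed G (rs ?S) p q} \<le> k" if "p \<in> rs ?S ` verts G" for p
      using deg[of ?S p] that unfolding im by (auto simp: rs_def[abs_def])
    then show ?case using uv coll by (rule collapses.merge)
  qed
  from this[OF \<open>finite M\<close>] have "collapses k G (rs {})" by simp
  then show ?thesis by (simp add: rs_def[abs_def])
qed

section \<open>Contracting along an involution\<close>

text \<open>Only the vertices \<open>y\<close> adjacent to exactly one of \<open>x\<close> and \<open>\<sigma> x\<close> can give rise to red edges at the
  pair \<open>{x, \<sigma> x}\<close>.\<close>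

lemma collapses_involution:
  assumes fin: "finite (verts G)"
    and \<sigma>: "\<And>x. x \<in> verts G \<Longrightarrow> \<sigma> x \<in> verts G" "\<And>x. x \<in> verts G \<Longrightarrow> \<sigma> (\<sigma> x) = x"
    and hom: "\<And>x y. \<lbrakk>x \<in> verts G; y \<in> verts G; adj G x y\<rbrakk> \<Longrightarrow> adj G (\<sigma> x) (\<sigma> y)"
    and M: "M \<subseteq> verts G" "\<And>x. x \<in> verts G \<Longrightarrow> x \<in> M \<longleftrightarrow> \<sigma> x \<notin> M"
    and deg: "\<And>x. x \<in> verts G \<Longrightarrow> 2 * card {y\<in>verts G. adj G x y \<and> \<not> adj G x (\<sigma> y)} \<le> k"
    and last: "collapses k G (\<lambda>x. if x \<in> M then \<sigma> x else x)"
  shows "collapses k G (\<lambda>x. x)"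
proof (rule collapses_stage[of G M "\<lambda>x. x" \<sigma>])
  fix S p
  assume S: "S \<subseteq> M" and "p \<in> (\<lambda>x. x) ` verts G - S"
  then have p: "p \<in> verts G" "p \<notin> S" by auto
  define g where "g x = (if x \<in> S then \<sigma> x else x)" for x
  define D where "D x = {y\<in>verts G. adj G x y \<and> \<not> adj G x (\<sigma> y)}" for x
  have fibre: "x = y \<or> x = \<sigma> y" if "g x = g y" "x \<in> verts G" "y \<in> verts G" for x y
    using that \<sigma> by (metis g_def)
  have gp: "g p = p" using p by (simp add: g_def)
  have "{q. mixed G g p q} \<subseteq> g ` (D p \<union> D (\<sigma> p))"
  proof
    fix q assume "q \<in> {q. mixed G g p q}"
    then obtain x y x' y' where V: "x \<in> verts G" "y \<in> verts G" "x' \<in> verts G" "y' \<in> verts G"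
      and g: "g x = p" "g y = q" "g x' = p" "g y' = q" and a: "adj G x y" "\<not> adj G x' y'"
      by (auto simp: mixed_def)
    have "x = p \<or> x = \<sigma> p" using fibre[of x p] V g gp p by simp
    \<comment> \<open>Otherwise \<open>hom\<close> makes all four pairs between the orbits of
      \<open>x\<close> and \<open>y\<close> adjacent, and no red edge could join \<open>p\<close>
      and \<open>q\<close>.\<close>
    moreover have "y \<in> D x"
    proof (rule ccontr)
      assume "y \<notin> D x"
      then have 1: "adj G x (\<sigma> y)" using a V by (simp add: D_def)
      have 2: "adj G (\<sigma> x) (\<sigma> y)" using hom a V by blast
      have 3: "adj G (\<sigma> x) y" using hom[OF V(1) \<sigma>(1)[OF V(2)] 1] \<sigma>(2)[OF V(2)] by simp
      have "x' = x \<or> x' = \<sigma> x" using fibre[of x' x] g V by simp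
      moreover have "y' = y \<or> y' = \<sigma> y" using fibre[of y' y] g V by simp
      ultimately show False using 1 2 3 a by metis
    qed
    ultimately show "q \<in> g ` (D p \<union> D (\<sigma> p))" using g(2) by blast
  qed
  moreover have "finite (D x)" for x using fin by (simp add: D_def)
  ultimately have "card {q. mixed G g p q} \<le> card (D p \<union> D (\<sigma> p))"
    by (intro surj_card_le) auto
  also have "\<dots> \<le> card (D p) + card (D (\<sigma> p))" by (rule card_Un_le)
  \<comment> \<open>The factor 2 in \<open>deg\<close> leaves half of \<open>k\<close> for each
    member of the orbit.\<close>
  also have "\<dots> \<le> k" using deg[OF p(1)] deg[OF \<sigma>(1)[OF p(1)]] by (simp add: D_def)
  finally show "card {q. mixed G (\<lambda>x. if x \<in> S then \<sigma> x else x) p q} \<le> k"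
    by (simp add: g_def[abs_def])
next
  fix x assume "x \<in> M"
  then have "x \<in> verts G" using M(1) by blast
  then show "\<sigma> x \<in> (\<lambda>x. x) ` verts G - M" using \<sigma>(1) M(2) \<open>x \<in> M\<close> by simp
qed (use fin M(1) last in simp_all)

section \<open>Contracting along a pairing of names\<close>

definition closed_nbhd :: "'a ugraph \<Rightarrow> 'a \<Rightarrow> 'a set" where
  "closed_nbhd G x = {y. y = x \<or> adj G x y}"

text \<open>Edges may shrink to a vertex. As the names are themselves vertices of \<open>G\<close>,
  adjacency in the quotient is confined to closed neighbourhoods in \<open>G\<close>, and counting
  there bounds red degrees.\<close>

definition weak_hom :: "'a ugraph \<Rightarrow> ('a \<Rightarrow> 'a) \<Rightarrow> bool" where
  "weak_hom G r \<longleftrightarrow> r ` verts G \<subseteq> verts G \<and>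
     (\<forall>x\<in>verts G. \<forall>y\<in>verts G. adj G x y \<longrightarrow> r y \<in> closed_nbhd G (r x))"

lemma weak_hom_comp:
  assumes "weak_hom G r" "weak_hom G h"
  shows "weak_hom G (h \<circ> r)"
  unfolding weak_hom_def
proof (intro conjI ballI impI)
  have r: "r x \<in> verts G" if "x \<in> verts G" for x
    using assms(1) that by (auto simp: weak_hom_def)
  show "(h \<circ> r) ` verts G \<subseteq> verts G"
    using r assms(2) by (auto simp: weak_hom_def)
  fix x y assume xy: "x \<in> verts G" "y \<in> verts G" "adj G x y"
  then have "r y = r x \<or> adj G (r x) (r y)"
    using assms(1) by (simp add: weak_hom_def closed_nbhd_def)
  then show "(h \<circ> r) y \<in> closed_nbhd G ((h \<circ> r) x)"
    using assms(2) r[OF xy(1)] r[OF xy(2)] by (auto simp: weak_hom_def closed_nbhd_def)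
qed

text \<open>A red edge at \<open>p\<close> comes from an edge of \<open>G\<close>, hence from a name
  in the closed neighbourhood of \<open>p\<close>, or of \<open>\<tau> p\<close> once the pair is
  merged. Colours are ignored in the count, except for the black edge allowed in
  \<open>single\<close>.\<close>

lemma collapses_pairing:
  assumes fin: "finite (verts G)" and r: "weak_hom G r"
    and \<tau>: "\<And>p. p \<in> r ` verts G \<Longrightarrow> \<tau> p \<in> r ` verts G" "\<And>p. p \<in> r ` verts G \<Longrightarrow> \<tau> (\<tau> p) = p"
    and M: "M \<subseteq> r ` verts G" "\<And>p. p \<in> r ` verts G \<Longrightarrow> p \<in> M \<longleftrightarrow> \<tau> p \<notin> M"
    and pair: "\<And>p. p \<in> r ` verts G \<Longrightarrow>
       card ((closed_nbhd G p \<union> closed_nbhd G (\<tau> p)) \<inter> r ` verts G - {p, \<tau> p}) \<le> k"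
    and single: "\<And>p. p \<in> r ` verts G \<Longrightarrow> card (closed_nbhd G p \<inter> r ` verts G - {p}) \<le> k \<or>
       black G r p (\<tau> p) \<and> card (closed_nbhd G p \<inter> r ` verts G - {p, \<tau> p}) \<le> k"
    and last: "collapses k G (\<lambda>x. if r x \<in> M then \<tau> (r x) else r x)"
  shows "collapses k G r"
proof (rule collapses_stage[of G M r \<tau>])
  fix S p
  assume S: "S \<subseteq> M" and "p \<in> r ` verts G - S"
  then have p: "p \<in> r ` verts G" "p \<notin> S" by auto
  define g where "g q = (if q \<in> S then \<tau> q else q)" for q
  let ?R = "{q. mixed G (\<lambda>x. g (r x)) p q}"
  have fibre: "q = p \<or> q = \<tau> p \<and> \<tau> p \<in> S" if "g q = p" "q \<in> r ` verts G" for q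
    using that \<tau>(2)[of q] by (auto simp: g_def split: if_splits)
  have nb: "\<exists>x y. x \<in> verts G \<and> y \<in> verts G \<and> g (r x) = p \<and> g (r y) = q \<and>
      r y \<in> closed_nbhd G (r x) \<inter> r ` verts G" if "q \<in> ?R" for q
    using that r unfolding mixed_def weak_hom_def by blast
  have bound: "card ?R \<le> k" if "?R \<subseteq> g ` W" "card W \<le> k" "W \<subseteq> r ` verts G" for W
    using surj_card_le[OF _ that(1)] finite_subset[OF that(3)] fin that(2) by fastforce
  have "card ?R \<le> k"
  proof (cases "\<tau> p \<in> S")
    \<comment> \<open>The pair is merged: both closed neighbourhoods count, but a name inside the
      pair would now be \<open>p\<close> itself.\<close>
    case True
    let ?W = "(closed_nbhd G p \<union> closed_nbhd G (\<tau> p)) \<inter> r ` verts G - {p, \<tau> p}"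
    have "?R \<subseteq> g ` ?W"
    proof
      fix q assume q: "q \<in> ?R"
      then obtain x y where xy: "x \<in> verts G" "g (r x) = p" "g (r y) = q"
        "r y \<in> closed_nbhd G (r x) \<inter> r ` verts G" using nb by blast
      have "r x = p \<or> r x = \<tau> p" using fibre xy by blast
      moreover have "r y \<noteq> p" "r y \<noteq> \<tau> p"
        using q xy(3) p True \<tau>(2)[OF p(1)] by (auto simp: mixed_def g_def)
      ultimately have "r y \<in> ?W" using xy(4) by (simp only: Diff_iff Int_iff Un_iff insert_iff empty_iff) metis
      then show "q \<in> g ` ?W" using xy(3) by (metis imageI)
    qed
    then show ?thesis using pair[OF p(1)] by (intro bound) auto
  next
    case False
    have W: "\<exists>x y. x \<in> verts G \<and> y \<in> verts G \<and> g (r y) = q \<and> r x = p \<and> r y \<noteq> p \<and>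
        r y \<in> closed_nbhd G p \<inter> r ` verts G" if q: "q \<in> ?R" for q
    proof -
      obtain x y where xy: "x \<in> verts G" "y \<in> verts G" "g (r x) = p" "g (r y) = q"
        "r y \<in> closed_nbhd G (r x) \<inter> r ` verts G" using nb[OF q] by blast
      have "r x = p" using fibre[OF xy(3)] xy(1) False by blast
      moreover have "r y \<noteq> p" using q xy(4) p(2) by (auto simp: mixed_def g_def)
      ultimately show ?thesis using xy by blast
    qed
    show ?thesis
    proof (cases "card (closed_nbhd G p \<inter> r ` verts G - {p}) \<le> k")
      case True
      have "?R \<subseteq> g ` (closed_nbhd G p \<inter> r ` verts G - {p})"
      proof
        fix q assume "q \<in> ?R"
        then obtain y where "g (r y) = q" "r y \<in> closed_nbhd G p \<inter> r ` verts G - {p}"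
          using W by (metis Diff_iff singletonD)
        then show "q \<in> g ` (closed_nbhd G p \<inter> r ` verts G - {p})" by (metis imageI)
      qed
      then show ?thesis using True by (intro bound) auto
    next
      case no: False
      with single[OF p(1)] have b: "black G r p (\<tau> p)"
        and c: "card (closed_nbhd G p \<inter> r ` verts G - {p, \<tau> p}) \<le> k" by auto
      have "?R \<subseteq> g ` (closed_nbhd G p \<inter> r ` verts G - {p, \<tau> p})"
      proof
        fix q assume q: "q \<in> ?R"
        then obtain x y where xy: "x \<in> verts G" "y \<in> verts G" "g (r y) = q" "r x = p" "r y \<noteq> p"
          "r y \<in> closed_nbhd G p \<inter> r ` verts G" using W by blast
        \<comment> \<open>Neither \<open>p\<close> nor \<open>\<tau> p\<close> has been merged away,
          so a red edge between them needs a non-adjacent pair between their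
          \<open>r\<close>-fibres, against \<open>b\<close>.\<close>
        have "r y \<noteq> \<tau> p"
        proof
          assume ry: "r y = \<tau> p"
          then have "q = \<tau> p" using xy(3) False by (simp add: g_def)
          obtain x' y' where *: "x' \<in> verts G" "y' \<in> verts G" "g (r x') = p" "g (r y') = \<tau> p"
            "\<not> adj G x' y'" using q \<open>q = \<tau> p\<close> by (auto simp: mixed_def)
          have "r x' = p" using fibre[OF *(3)] *(1) False by blast
          moreover have "r y' = \<tau> p"
          proof (cases "r y' \<in> S")
            case True
            then have "\<tau> (r y') = \<tau> p" using *(4) by (simp add: g_def)
            then have "r y' = p" using \<tau>(2)[OF imageI[OF *(2)]] \<tau>(2)[OF p(1)] by metis
            then show ?thesis using True p(2) by simp
          next
            case False
            then show ?thesis using *(4) by (simp add: g_def)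
          qed
          ultimately show False using b * by (auto simp: black_def)
        qed
        then have "r y \<in> closed_nbhd G p \<inter> r ` verts G - {p, \<tau> p}"
          using xy(5,6) by (simp only: Diff_iff insert_iff empty_iff simp_thms)
        then show "q \<in> g ` (closed_nbhd G p \<inter> r ` verts G - {p, \<tau> p})"
          using xy(3) by (metis imageI)
      qed
      then show ?thesis using c by (intro bound) auto
    qed
  qed
  then show "card {q. mixed G (\<lambda>x. if r x \<in> S then \<tau> (r x) else r x) p q} \<le> k"
    by (simp add: g_def)
next
  fix p assume "p \<in> M"
  then have "p \<in> r ` verts G" using M(1) by blast
  then show "\<tau> p \<in> r ` verts G - M" using \<tau>(1) M(2) \<open>p \<in> M\<close> by simp
qed (fact fin M(1) last)+

section \<open>Red degree after the first contraction\<close>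

text \<open>Only the first contraction is inspected. The input has no red edges, so each vertex in
  exactly one of the two closed neighbourhoods, other than \<open>u\<close> and \<open>v\<close>,
  gets a red edge to the merged vertex. By \<open>ex\<close> the \<open>LEAST\<close> is
  attained.\<close>

lemma tww_ge:
  assumes ex: "\<exists>S. is_d_sequence m G S" and G: "is_graph G" "2 \<le> card (verts G)"
    and sd: "\<And>u v. \<lbrakk>u \<in> verts G; v \<in> verts G; u \<noteq> v\<rbrakk> \<Longrightarrow>
      k \<le> card (sym_diff (closed_nbhd G u) (closed_nbhd G v) - {u, v})"
  shows "k \<le> tww G"
proof -
  let ?n = "card (verts G)" and ?T = "trigraph_of G"
  obtain S where S: "is_d_sequence (tww G) G S"
    using LeastI_ex[of "\<lambda>d. \<exists>S. is_d_sequence d G S"] ex unfolding tww_def by blast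
  then have S': "S ?n = ?T" "\<forall>i\<in>{1..?n}. is_d_trigraph (tww G) (S i)"
    "\<forall>i\<in>{2..?n}. is_contraction (S i) (S (i - 1))"
    unfolding is_d_sequence_def by blast+
  have "is_contraction (S ?n) (S (?n - 1))"
    using bspec[OF S'(3), of ?n] G(2) by simp
  then obtain u v w where uvw: "u \<in> verts G" "v \<in> verts G" "u \<noteq> v"
    and C: "S (?n - 1) = contract ?T u v w" and w: "w \<notin> verts G - {u, v}"
    unfolding S'(1) is_contraction_def by (auto simp: trigraph_of_def)
  have V: "x \<in> verts G" "y \<in> verts G" if "adj G x y" for x y
    using that G(1) by (auto simp: adj_def is_graph_def)
  have N: "nbrs ?T x = {y. adj G x y}" for x
    by (simp add: nbrs_def trigraph_of_def adj_def)
  define D where "D = sym_diff (closed_nbhd G u) (closed_nbhd G v) - {u, v}"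
  have D: "x \<in> verts G" "x \<in> sym_diff (nbrs ?T u) (nbrs ?T v)" "x \<noteq> u" "x \<noteq> v" if "x \<in> D" for x
    using that V by (auto simp: D_def N closed_nbhd_def)
  let ?C = "contract ?T u v w"
  have sub: "(\<lambda>x. {w, x}) ` D \<subseteq> {e \<in> red ?C. w \<in> e}"
  proof (rule image_subsetI)
    fix x assume "x \<in> D"
    then have "{w, x} \<in> {{w, x} | x. x \<in> (nbrs ?T u - nbrs ?T v) \<union> (nbrs ?T v - nbrs ?T u) \<and>
        x \<noteq> u \<and> x \<noteq> v}" using D(2-4) by blast
    then show "{w, x} \<in> {e \<in> red ?C. w \<in> e}" by (simp add: contract_def)
  qed
  have "is_d_trigraph (tww G) ?C"
    unfolding C[symmetric] using bspec[OF S'(2), of "?n - 1"] G(2) by simp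
  moreover have "w \<in> verts ?C" by (simp add: contract_def)
  ultimately have d: "card {e \<in> red ?C. w \<in> e} \<le> tww G" and tri: "is_trigraph ?C"
    unfolding is_d_trigraph_def by blast+
  have "finite (red ?C)"
  proof (rule finite_subset)
    show "red ?C \<subseteq> Pow (verts ?C)" using tri by (auto simp: is_trigraph_def)
    show "finite (Pow (verts ?C))" using tri by (simp add: is_trigraph_def is_graph_def)
  qed
  moreover have "inj_on (\<lambda>x. {w, x}) D"
    by (auto simp: inj_on_def doubleton_eq_iff)
  ultimately have "card D \<le> card {e \<in> red ?C. w \<in> e}"
    using card_mono[OF _ sub] by (simp add: card_image)
  then show ?thesis using d sd[OF uvw] by (simp add: D_def)
qed

section \<open>Hypercubes\<close>

definition cube :: "nat \<Rightarrow> (nat \<Rightarrow> nat) set" where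
  "cube d = {..<d} \<rightarrow>\<^sub>E {0, 1}"

text \<open>Truncated subtraction swaps 0 and 1 but is not an involution on other values, whence the
  cube hypothesis in \<open>flip_flip\<close>.\<close>

definition flip :: "nat \<Rightarrow> (nat \<Rightarrow> nat) \<Rightarrow> nat \<Rightarrow> nat" where
  "flip i a = a(i := 1 - a i)"

definition nbhd :: "nat \<Rightarrow> (nat \<Rightarrow> nat) \<Rightarrow> (nat \<Rightarrow> nat) set" where
  "nbhd d a = insert a ((\<lambda>i. flip i a) ` {..<d})"

text \<open>A chain from the whole cube at \<open>l = 0\<close> to one point at
  \<open>l = d\<close>: the sets of names that survive successive rounds.\<close>

definition face :: "nat \<Rightarrow> nat \<Rightarrow> (nat \<Rightarrow> nat) set" where
  "face d l = {a \<in> cube d. \<forall>i<l. a i = 0}"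

lemma cube_iff: "a \<in> cube d \<longleftrightarrow> (\<forall>i<d. a i = 0 \<or> a i = 1) \<and> (\<forall>i. d \<le> i \<longrightarrow> a i = undefined)"
  by (auto simp: cube_def PiE_iff extensional_def not_less)

lemma cube_bit: "a \<in> cube d \<Longrightarrow> i < d \<Longrightarrow> a i = 0 \<or> a i = 1"
  by (simp add: cube_iff)

lemma flip_apply: "flip i a j = (if j = i then 1 - a j else a j)"
  by (simp add: flip_def)

text \<open>No natural number equals 1 minus itself, even with truncation, so this holds outside the
  cube as well.\<close>

lemma flip_apply_eq_iff: "flip i a j = a j \<longleftrightarrow> j \<noteq> i"
  unfolding flip_apply by simp arith

lemma flip_neq [simp]: "flip i a \<noteq> a" "a \<noteq> flip i a"
  using flip_apply_eq_iff by metis+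

lemma flip_eq_iff [simp]: "flip i a = flip j a \<longleftrightarrow> i = j"
  using flip_apply_eq_iff by metis

lemma flip_cube:
  assumes "a \<in> cube d" "i < d"
  shows "flip i a \<in> cube d"
  unfolding cube_iff
proof (intro conjI allI impI)
  fix j
  show "flip i a j = 0 \<or> flip i a j = 1" if "j < d"
    using cube_bit[OF assms(1) that] by (cases "j = i") (simp_all add: flip_apply, arith)
  show "flip i a j = undefined" if "d \<le> j"
    using assms that by (simp add: flip_apply cube_iff)
qed

lemma flip_flip: "a \<in> cube d \<Longrightarrow> i < d \<Longrightarrow> flip i (flip i a) = a"
  using cube_bit[of a d i] by (intro ext) (simp add: flip_apply, arith)

lemma flip_commute: "flip i (flip j a) = flip j (flip i a)"
  by (auto simp: flip_def fun_eq_iff)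

lemma nbhd_subset: "a \<in> cube d \<Longrightarrow> nbhd d a \<subseteq> cube d"
  using flip_cube[of a d] unfolding nbhd_def by blast

lemma finite_nbhd [simp]: "finite (nbhd d a)"
  by (simp add: nbhd_def)

lemma card_nbhd: "card (nbhd d a) = d + 1"
proof -
  have "inj_on (\<lambda>i. flip i a) {..<d}" by (simp add: inj_on_def)
  moreover have "a \<notin> (\<lambda>i. flip i a) ` {..<d}" by auto
  ultimately show ?thesis by (simp add: nbhd_def card_image)
qed

text \<open>At a coordinate \<open>i\<close> where \<open>a\<close> and \<open>b\<close> differ, a
  common element differs from one of them and is therefore the flip of that one at
  \<open>i\<close>.\<close>

lemma card_nbhd_Int:
  assumes "a \<in> cube d" "b \<in> cube d" "a \<noteq> b"
  shows "card (nbhd d a \<inter> nbhd d b) \<le> 2"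
proof -
  obtain i where i: "a i \<noteq> b i" using assms(3) by blast
  have "x \<in> {flip i a, flip i b}" if x: "x \<in> nbhd d a \<inter> nbhd d b" for x
  proof (cases "x i = a i")
    case False
    then obtain j where j: "x = flip j a" using x by (auto simp: nbhd_def)
    then have "j = i" using False by (metis flip_apply)
    then show ?thesis using j by simp
  next
    case True
    then have "x i \<noteq> b i" using i by simp
    then obtain j where j: "x = flip j b" using x by (auto simp: nbhd_def)
    then have "j = i" using \<open>x i \<noteq> b i\<close> by (metis flip_apply)
    then show ?thesis using j by simp
  qed
  then have "card (nbhd d a \<inter> nbhd d b) \<le> card {flip i a, flip i b}"
    by (intro card_mono) auto
  also have "\<dots> \<le> 2" by (simp add: card_insert_if)
  finally show ?thesis .
qed

section \<open>Faces of the cube\<close>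

lemma face_0 [simp]: "face d 0 = cube d"
  by (simp add: face_def)

lemma face_full: "face d d = {\<lambda>i\<in>{..<d}. 0}"
proof -
  have "a \<in> face d d \<longleftrightarrow> a = (\<lambda>i\<in>{..<d}. 0)" for a
    by (auto simp: face_def cube_iff fun_eq_iff not_less)
  then show ?thesis by blast
qed

lemma face_subset: "face d l \<subseteq> cube d"
  by (auto simp: face_def)

lemma flip_face: "a \<in> face d l \<Longrightarrow> l \<le> i \<Longrightarrow> i < d \<Longrightarrow> flip i a \<in> face d l"
  using flip_cube[of a d i] by (simp add: face_def flip_apply)

lemma nbhd_face:
  assumes "a \<in> face d l"
  shows "nbhd d a \<inter> face d l \<subseteq> insert a ((\<lambda>i. flip i a) ` {l..<d})"
proof
  fix b assume b: "b \<in> nbhd d a \<inter> face d l"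
  then consider "b = a" | i where "i < d" "b = flip i a" by (auto simp: nbhd_def)
  then show "b \<in> insert a ((\<lambda>i. flip i a) ` {l..<d})"
  proof cases
    case 2
    have "l \<le> i"
    proof (rule ccontr)
      assume "\<not> l \<le> i"
      then have "a i = 0" "flip i a i = 0" using assms b 2 by (auto simp: face_def)
      then show False by (simp add: flip_apply)
    qed
    then show ?thesis using 2 by simp
  qed simp
qed

lemma card_nbhd_face:
  assumes "a \<in> face d l"
  shows "card (nbhd d a \<inter> face d l) \<le> d - l + 1"
proof -
  have "card (nbhd d a \<inter> face d l) \<le> card (insert a ((\<lambda>i. flip i a) ` {l..<d}))"
    using nbhd_face[OF assms] by (intro card_mono) auto
  also have "\<dots> \<le> Suc (card ((\<lambda>i. flip i a) ` {l..<d}))" by (rule card_insert_le_m1) auto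
  also have "\<dots> \<le> Suc (card {l..<d})" using card_image_le[of "{l..<d}"] by blast
  finally show ?thesis by simp
qed

text \<open>The flip at \<open>l\<close> exchanges \<open>a\<close> and \<open>flip l a\<close>, so
  each of the two contributes itself and only its \<open>d - l - 1\<close> flips at higher
  coordinates.\<close>

lemma card_nbhd_flip_face:
  assumes "a \<in> face d l" "l < d"
  shows "card ((nbhd d a \<union> nbhd d (flip l a)) \<inter> face d l) \<le> 2 * (d - l)"
proof -
  define b where "b = flip l a"
  have b: "b \<in> face d l" using flip_face assms by (simp add: b_def)
  have fb: "flip l b = a" using flip_flip assms face_subset unfolding b_def by blast
  have split: "{l..<d} = insert l {Suc l..<d}" using assms(2) by auto
  let ?T = "\<lambda>a. insert a ((\<lambda>i. flip i a) ` {Suc l..<d})"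
  have "nbhd d a \<inter> face d l \<subseteq> ?T a \<union> ?T b"
    using nbhd_face[OF assms(1)] unfolding split by (auto simp: b_def)
  moreover have "nbhd d b \<inter> face d l \<subseteq> ?T a \<union> ?T b"
    using nbhd_face[OF b] unfolding split by (auto simp: fb)
  ultimately have "card ((nbhd d a \<union> nbhd d b) \<inter> face d l) \<le> card (?T a \<union> ?T b)"
    by (intro card_mono) auto
  also have "\<dots> \<le> card (?T a) + card (?T b)" by (rule card_Un_le)
  also have "card (?T e) \<le> d - l" for e
    using card_image_le[of "{Suc l..<d}" "\<lambda>i. flip i e"] assms(2)
    by (auto simp: card_insert_if)
  then have "card (?T a) + card (?T b) \<le> 2 * (d - l)" by (metis add_mono mult_2)
  finally show ?thesis by (simp add: b_def)
qed

text \<open>Zeroing coordinate \<open>l\<close> absorbs a flip at \<open>l\<close> and commutes with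
  every other flip.\<close>

lemma nbhd_zero:
  assumes "b \<in> nbhd d a"
  shows "b(l := 0) \<in> nbhd d (a(l := 0))"
proof -
  consider "b = a" | i where "i < d" "b = flip i a" using assms by (auto simp: nbhd_def)
  then show ?thesis
  proof cases
    case 2
    then have "b(l := 0) = a(l := 0) \<or> b(l := 0) = flip i (a(l := 0))"
      by (cases "i = l") (auto simp: flip_def fun_eq_iff)
    then show ?thesis using 2 by (auto simp: nbhd_def)
  qed (simp add: nbhd_def)
qed

lemma zero_face: "a \<in> face d l \<Longrightarrow> l < d \<Longrightarrow> a(l := 0) \<in> face d (Suc l)"
  by (auto simp: face_def cube_iff less_Suc_eq)

lemma zero_image_face:
  assumes "l < d"
  shows "(\<lambda>a. a(l := 0)) ` face d l = face d (Suc l)"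
proof
  show "(\<lambda>a. a(l := 0)) ` face d l \<subseteq> face d (Suc l)" using zero_face assms by blast
  show "face d (Suc l) \<subseteq> (\<lambda>a. a(l := 0)) ` face d l"
  proof
    fix a assume a: "a \<in> face d (Suc l)"
    then have "a = a(l := 0)" "a \<in> face d l" by (auto simp: face_def)
    then show "a \<in> (\<lambda>a. a(l := 0)) ` face d l" by (metis imageI)
  qed
qed

lemma flip_eq_zero: "a l = 1 \<Longrightarrow> flip l a = a(l := 0)"
  by (simp add: flip_def)

section \<open>Strong products of hypercubes\<close>

lemma verts_hypercube [simp]: "verts (hypercube d) = cube d"
  by (simp add: hypercube_def cube_def)

lemma adj_hypercube:
  "adj (hypercube d) a b \<longleftrightarrow> a \<in> cube d \<and> b \<in> nbhd d a - {a}"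
proof -
  let ?P = "\<lambda>a b. a \<in> cube d \<and> b \<in> cube d \<and> card {i\<in>{..<d}. a i \<noteq> b i} = 1"
  have "{i\<in>{..<d}. a i \<noteq> b i} = {i\<in>{..<d}. b i \<noteq> a i}" for a b :: "nat \<Rightarrow> nat"
    by auto
  then have "?P a b \<longleftrightarrow> ?P b a" for a b
    by metis
  then have "adj (hypercube d) a b \<longleftrightarrow> ?P a b"
    unfolding adj_def hypercube_def cube_def[symmetric] ugraph.select_convs
    by (intro doubleton_mem_iff)
  also have "\<dots> \<longleftrightarrow> a \<in> cube d \<and> b \<in> nbhd d a - {a}"
  proof (intro iffI conjI; (elim conjE)?)
    assume a: "a \<in> cube d" and b: "b \<in> cube d" and 1: "card {i\<in>{..<d}. a i \<noteq> b i} = 1"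
    then obtain i where i: "{i\<in>{..<d}. a i \<noteq> b i} = {i}" by (auto simp: card_1_singleton_iff)
    then have "i < d" "a i \<noteq> b i" by auto
    have "b j = flip i a j" for j
    proof (cases "j < d")
      case True
      show ?thesis
      proof (cases "j = i")
        case True
        then show ?thesis
          using \<open>a i \<noteq> b i\<close> cube_bit[OF a \<open>i < d\<close>] cube_bit[OF b \<open>i < d\<close>]
          by (elim disjE) (simp_all add: flip_apply)
      next
        case False
        then have "a j = b j" using i True by blast
        then show ?thesis using False by (simp add: flip_apply)
      qed
    next
      case False
      then show ?thesis using a b \<open>i < d\<close> by (simp add: flip_apply cube_iff)
    qed
    then have "b = flip i a" by blast
    then show "b \<in> nbhd d a - {a}" using \<open>i < d\<close> by (simp add: nbhd_def)
  next
    assume "a \<in> cube d" "b \<in> nbhd d a - {a}"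
    then obtain i where i: "i < d" "b = flip i a" by (auto simp: nbhd_def)
    then have "a j \<noteq> b j \<longleftrightarrow> j = i" for j using flip_apply_eq_iff by metis
    then have "{j\<in>{..<d}. a j \<noteq> b j} = {i}" using i(1) by simp blast
    then show "card {i\<in>{..<d}. a i \<noteq> b i} = 1" by simp
  next
    assume "a \<in> cube d" "b \<in> nbhd d a - {a}"
    then show "b \<in> cube d" using nbhd_subset by blast
  qed
  finally show ?thesis .
qed

lemma verts_strong_product [simp]: "verts (G \<boxtimes> H) = verts G \<times> verts H"
  by (simp add: strong_product_def)

lemma doubleton_pair_mem_iff:
  assumes "\<And>u i v j. P u i v j \<longleftrightarrow> P v j u i"
  shows "{(u, i), (v, j)} \<in> {{(u, i), (v, j)} | u i v j. P u i v j} \<longleftrightarrow> P u i v j"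
  using assms by (auto simp: doubleton_eq_iff)

lemma adj_strong_product:
  "adj (G \<boxtimes> H) (u, i) (v, j) \<longleftrightarrow> (u, i) \<in> verts G \<times> verts H \<and> (v, j) \<in> verts G \<times> verts H \<and>
     (u = v \<and> adj H i j \<or> i = j \<and> adj G u v \<or> adj G u v \<and> adj H i j)"
proof -
  let ?P = "\<lambda>u i v j. (u, i) \<in> verts G \<times> verts H \<and> (v, j) \<in> verts G \<times> verts H \<and>
       (u = v \<and> {i, j} \<in> edges H \<or> i = j \<and> {u, v} \<in> edges G \<or>
        {u, v} \<in> edges G \<and> {i, j} \<in> edges H)"
  have "?P u i v j \<longleftrightarrow> ?P v j u i" for u i v j
    by (auto simp: insert_commute)
  then have "adj (G \<boxtimes> H) (u, i) (v, j) \<longleftrightarrow> ?P u i v j"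
    unfolding adj_def strong_product_def ugraph.select_convs by (rule doubleton_pair_mem_iff)
  then show ?thesis by (simp only: adj_def)
qed

lemma nbhd_self [simp]: "a \<in> nbhd d a"
  by (simp add: nbhd_def)

lemma adj_cubes:
  "adj (hypercube c \<boxtimes> hypercube d) (a, x) (b, y) \<longleftrightarrow>
     a \<in> cube c \<and> x \<in> cube d \<and> (b, y) \<in> nbhd c a \<times> nbhd d x - {(a, x)}"
  using nbhd_subset[of a c] nbhd_subset[of x d]
  by (auto simp: adj_strong_product adj_hypercube)

lemma closed_nbhd_cubes:
  assumes "a \<in> cube c" "x \<in> cube d"
  shows "closed_nbhd (hypercube c \<boxtimes> hypercube d) (a, x) = nbhd c a \<times> nbhd d x"
  using assms by (auto simp: closed_nbhd_def adj_cubes)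

lemma is_graph_cubes: "is_graph (hypercube c \<boxtimes> hypercube d)"
proof -
  let ?Q = "hypercube c \<boxtimes> hypercube d"
  have "e \<subseteq> verts ?Q \<and> card e = 2" if e: "e \<in> edges ?Q" for e
  proof -
    obtain a x b y where "e = {(a, x), (b, y)}" using e by (auto simp: strong_product_def)
    then have "adj ?Q (a, x) (b, y)" using e by (simp add: adj_def)
    then have "a \<in> cube c" "x \<in> cube d" "b \<in> cube c" "y \<in> cube d" "(a, x) \<noteq> (b, y)"
      using nbhd_subset[of a c] nbhd_subset[of x d] by (auto simp: adj_cubes)
    then show ?thesis
      using \<open>e = _\<close> by simp
  qed
  moreover have "finite (cube n)" for n by (simp add: cube_def finite_PiE)
  ultimately show ?thesis by (simp add: is_graph_def)
qed

text \<open>Closed neighbourhoods in the strong product are products, so the condition splits into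
  the two factors.\<close>

lemma weak_hom_cubes:
  assumes "\<And>a. a \<in> cube c \<Longrightarrow> h a \<in> cube c" "\<And>a b. a \<in> cube c \<Longrightarrow> b \<in> nbhd c a \<Longrightarrow> h b \<in> nbhd c (h a)"
    and "\<And>x. x \<in> cube d \<Longrightarrow> g x \<in> cube d" "\<And>x y. x \<in> cube d \<Longrightarrow> y \<in> nbhd d x \<Longrightarrow> g y \<in> nbhd d (g x)"
  shows "weak_hom (hypercube c \<boxtimes> hypercube d) (map_prod h g)"
  unfolding weak_hom_def
proof (intro conjI ballI impI)
  let ?Q = "hypercube c \<boxtimes> hypercube d"
  show "map_prod h g ` verts ?Q \<subseteq> verts ?Q" using assms(1,3) by auto
  fix p q assume "p \<in> verts ?Q" "adj ?Q p q"
  then show "map_prod h g q \<in> closed_nbhd ?Q (map_prod h g p)"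
    using assms by (cases p; cases q) (auto simp: adj_cubes closed_nbhd_cubes)
qed

section \<open>Collapsing faces by zeroing coordinates\<close>

lemma id_image: "id ` A = A"
  by simp

lemma finite_cube [simp]: "finite (cube d)"
  by (simp add: cube_def finite_PiE)

lemma zero_cube: "a \<in> cube d \<Longrightarrow> l < d \<Longrightarrow> a(l := 0) \<in> cube d"
  by (simp add: cube_iff)

text \<open>The form shared by the degree counts: names lie in a box, and an exempt set
  \<open>D\<close> inside the box (a vertex or its pair) is subtracted in full.\<close>

lemma card_le_Times_Diff:
  assumes "W \<subseteq> (A \<times> B) - D" "card A \<le> m" "card B \<le> n" "finite A" "finite B" "D \<subseteq> A \<times> B"
  shows "card W \<le> m * n - card D"
proof -
  have "card W \<le> card (A \<times> B - D)" using assms by (intro card_mono) auto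
  also have "\<dots> = card A * card B - card D"
    using assms by (simp add: card_Diff_subset finite_subset[of D "A \<times> B"] card_cartesian_product)
  also have "\<dots> \<le> m * n - card D" using assms(2,3) by (intro diff_le_mono mult_le_mono)
  finally show ?thesis .
qed

text \<open>One round merges each \<open>(a, x)\<close> with \<open>(flip j a, x)\<close>. A merged
  pair has \<open>2 * (c - j)\<close> first and \<open>d + 1\<close> second coordinates to choose
  from, minus the pair; an unmerged vertex has \<open>c - j + 1\<close> and \<open>d + 1\<close>,
  minus itself and possibly its black partner.\<close>

lemma collapses_zero_fst:
  fixes c d :: nat
  defines "Q \<equiv> hypercube c \<boxtimes> hypercube d"
  assumes r: "weak_hom Q r" "r ` verts Q = face c j \<times> cube d" and "j < c"
    and pair: "2 * (c - j) * (d + 1) - 2 \<le> k"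
    and single: "(c - j + 1) * (d + 1) - 1 \<le> k \<or> (c - j + 1) * (d + 1) - 2 \<le> k \<and>
       (\<forall>a\<in>face c j. \<forall>x\<in>cube d. black Q r (a, x) (flip j a, x))"
    and step: "\<And>r'. weak_hom Q r' \<Longrightarrow> r' ` verts Q = face c (Suc j) \<times> cube d \<Longrightarrow> collapses k Q r'"
  shows "collapses k Q r"
proof -
  define \<tau> :: "_ \<Rightarrow> (nat \<Rightarrow> nat) \<times> (nat \<Rightarrow> nat)" where "\<tau> = map_prod (flip j) id"
  define M where "M = {p \<in> face c j \<times> cube d. fst p j = 1}"
  have cn: "closed_nbhd Q (a, x) = nbhd c a \<times> nbhd d x" if "a \<in> face c j" "x \<in> cube d" for a x
    using that face_subset closed_nbhd_cubes unfolding Q_def by blast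
  have fl: "flip j a \<in> face c j" "flip j (flip j a) = a" "a j = 0 \<or> a j = 1"
    if "a \<in> face c j" for a
  proof -
    have a: "a \<in> cube c" using that face_subset by blast
    show "flip j a \<in> face c j" using flip_face[OF that] \<open>j < c\<close> by simp
    show "flip j (flip j a) = a" using flip_flip[OF a \<open>j < c\<close>] .
    show "a j = 0 \<or> a j = 1" using cube_bit[OF a \<open>j < c\<close>] .
  qed
  show ?thesis
  proof (rule collapses_pairing[of Q r \<tau> M], unfold r(2))
    show "finite (verts Q)" by (simp add: Q_def)
    show "weak_hom Q r" by fact
    show "M \<subseteq> face c j \<times> cube d" by (auto simp: M_def)
    show "\<tau> p \<in> face c j \<times> cube d" "\<tau> (\<tau> p) = p" "p \<in> M \<longleftrightarrow> \<tau> p \<notin> M"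
      if "p \<in> face c j \<times> cube d" for p
    proof -
      obtain a x where p: "p = (a, x)" "a \<in> face c j" "x \<in> cube d" using \<open>p \<in> _\<close> by blast
      show "\<tau> p \<in> face c j \<times> cube d" "\<tau> (\<tau> p) = p" using p fl(1,2)[OF p(2)] by (simp_all add: \<tau>_def)
      show "p \<in> M \<longleftrightarrow> \<tau> p \<notin> M" using p fl(1,3)[OF p(2)] by (auto simp: \<tau>_def M_def flip_apply)
    qed
    fix p assume "p \<in> face c j \<times> cube d"
    then obtain a x where p: "p = (a, x)" and a: "a \<in> face c j" and x: "x \<in> cube d" by blast
    have nx: "nbhd d x \<subseteq> cube d" "card (nbhd d x) = d + 1"
      using nbhd_subset[OF x] card_nbhd by auto
    have na: "flip j a \<in> nbhd c a" using \<open>j < c\<close> by (simp add: nbhd_def)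
    have \<tau>: "\<tau> (a, x) = (flip j a, x)" by (simp add: \<tau>_def)
    let ?A = "(nbhd c a \<union> nbhd c (flip j a)) \<inter> face c j" and ?B = "nbhd c a \<inter> face c j"
    have "(closed_nbhd Q p \<union> closed_nbhd Q (\<tau> p)) \<inter> face c j \<times> cube d - {p, \<tau> p} \<subseteq>
       ?A \<times> nbhd d x - {p, \<tau> p}"
      unfolding p \<tau> cn[OF a x] cn[OF fl(1)[OF a] x] by blast
    moreover have "{p, \<tau> p} \<subseteq> ?A \<times> nbhd d x" using a fl(1)[OF a] by (simp add: \<tau> p)
    ultimately have "card ((closed_nbhd Q p \<union> closed_nbhd Q (\<tau> p)) \<inter> face c j \<times> cube d - {p, \<tau> p})
        \<le> 2 * (c - j) * (d + 1) - card {p, \<tau> p}"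
      using card_nbhd_flip_face[OF a \<open>j < c\<close>] nx(2) by (intro card_le_Times_Diff[of _ ?A "nbhd d x"]) auto
    also have "card {p, \<tau> p} = 2" by (simp add: \<tau> p)
    finally show "card ((closed_nbhd Q p \<union> closed_nbhd Q (\<tau> p)) \<inter> face c j \<times> cube d - {p, \<tau> p}) \<le> k"
      using pair by simp
    have B: "card (closed_nbhd Q p \<inter> face c j \<times> cube d - D) \<le> (c - j + 1) * (d + 1) - card D"
      if "D \<subseteq> ?B \<times> nbhd d x" for D
    proof (rule card_le_Times_Diff[of _ ?B "nbhd d x"])
      show "closed_nbhd Q p \<inter> face c j \<times> cube d - D \<subseteq> ?B \<times> nbhd d x - D"
        unfolding p cn[OF a x] by blast
    qed (use card_nbhd_face[OF a] nx(2) that in auto)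
    from single show "card (closed_nbhd Q p \<inter> face c j \<times> cube d - {p}) \<le> k \<or>
       black Q r p (\<tau> p) \<and> card (closed_nbhd Q p \<inter> face c j \<times> cube d - {p, \<tau> p}) \<le> k"
    proof
      assume "(c - j + 1) * (d + 1) - 1 \<le> k"
      moreover have "card (closed_nbhd Q p \<inter> face c j \<times> cube d - {p}) \<le> (c - j + 1) * (d + 1) - card {p}"
        using a by (intro B) (simp add: p)
      ultimately show ?thesis by simp
    next
      assume *: "(c - j + 1) * (d + 1) - 2 \<le> k \<and>
       (\<forall>a\<in>face c j. \<forall>x\<in>cube d. black Q r (a, x) (flip j a, x))"
      have "card (closed_nbhd Q p \<inter> face c j \<times> cube d - {p, \<tau> p}) \<le> (c - j + 1) * (d + 1) - card {p, \<tau> p}"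
        using a fl(1)[OF a] na by (intro B) (simp add: p \<tau>)
      also have "card {p, \<tau> p} = 2" by (simp add: \<tau> p)
      finally show ?thesis using * a x by (simp add: p \<tau>)
    qed
  next
    \<comment> \<open>Replacing the names with bit 1 by their partners amounts to zeroing coordinate
      \<open>j\<close>.\<close>
    let ?Z = "map_prod (\<lambda>a. a(j := 0)) id \<circ> r"
    have "weak_hom Q ?Z"
    proof (rule weak_hom_comp[OF r(1)])
      show "weak_hom Q (map_prod (\<lambda>a. a(j := 0)) id)"
        unfolding Q_def by (rule weak_hom_cubes) (use zero_cube nbhd_zero \<open>j < c\<close> in auto)
    qed
    moreover have "?Z ` verts Q = face c (Suc j) \<times> cube d"
      unfolding image_comp[symmetric] r(2)
      by (rule map_prod_surj_on[OF zero_image_face[OF \<open>j < c\<close>] id_image])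
    ultimately have "collapses k Q ?Z" by (rule step)
    moreover have "(if r p \<in> M then \<tau> (r p) else r p) = ?Z p" if "p \<in> verts Q" for p
    proof -
      have "r p \<in> face c j \<times> cube d" unfolding r(2)[symmetric] using that by (rule imageI)
      then obtain a x where rp: "r p = (a, x)" "a \<in> face c j" "x \<in> cube d" by blast
      show ?thesis
      proof (cases "a j = 1")
        case True
        then have "r p \<in> M" using rp by (simp add: M_def)
        then show ?thesis using rp(1) True by (simp add: \<tau>_def flip_eq_zero)
      next
        case False
        then have "r p \<notin> M" "a(j := 0) = a"
          using rp(1) fl(3)[OF rp(2)] by (simp_all add: M_def fun_upd_idem)
        then show ?thesis using rp(1) by simp
      qed
    qed
    ultimately show "collapses k Q (\<lambda>p. if r p \<in> M then \<tau> (r p) else r p)"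
      by (rule collapses_cong)
  qed
qed

text \<open>With the first factor shrunk to a point, one box of size at most
  \<open>2 * (d - l)\<close> covers merged and unmerged names alike.\<close>

lemma collapses_zero_snd:
  fixes c d :: nat
  defines "Q \<equiv> hypercube c \<boxtimes> hypercube d"
  assumes r: "weak_hom Q r" "r ` verts Q = face c c \<times> face d l" and "l < d" "2 * d \<le> k"
    and step: "\<And>r'. weak_hom Q r' \<Longrightarrow> r' ` verts Q = face c c \<times> face d (Suc l) \<Longrightarrow> collapses k Q r'"
  shows "collapses k Q r"
proof -
  define \<tau> :: "_ \<Rightarrow> (nat \<Rightarrow> nat) \<times> (nat \<Rightarrow> nat)" where "\<tau> = map_prod id (flip l)"
  define M where "M = {p \<in> face c c \<times> face d l. snd p l = 1}"
  have cn: "closed_nbhd Q (a, x) = nbhd c a \<times> nbhd d x" if "a \<in> face c c" "x \<in> face d l" for a x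
    using that face_subset closed_nbhd_cubes unfolding Q_def by blast
  have fl: "flip l x \<in> face d l" "flip l (flip l x) = x" "x l = 0 \<or> x l = 1"
    if "x \<in> face d l" for x
  proof -
    have x: "x \<in> cube d" using that face_subset by blast
    show "flip l x \<in> face d l" using flip_face[OF that] \<open>l < d\<close> by simp
    show "flip l (flip l x) = x" using flip_flip[OF x \<open>l < d\<close>] .
    show "x l = 0 \<or> x l = 1" using cube_bit[OF x \<open>l < d\<close>] .
  qed
  show ?thesis
  proof (rule collapses_pairing[of Q r \<tau> M], unfold r(2))
    show "finite (verts Q)" by (simp add: Q_def)
    show "weak_hom Q r" by fact
    show "M \<subseteq> face c c \<times> face d l" by (auto simp: M_def)
    show "\<tau> p \<in> face c c \<times> face d l" "\<tau> (\<tau> p) = p" "p \<in> M \<longleftrightarrow> \<tau> p \<notin> M"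
      if "p \<in> face c c \<times> face d l" for p
    proof -
      obtain a x where p: "p = (a, x)" "a \<in> face c c" "x \<in> face d l" using \<open>p \<in> _\<close> by blast
      show "\<tau> p \<in> face c c \<times> face d l" "\<tau> (\<tau> p) = p" using p fl(1,2)[OF p(3)] by (simp_all add: \<tau>_def)
      show "p \<in> M \<longleftrightarrow> \<tau> p \<notin> M" using p fl(1,3)[OF p(3)] by (auto simp: \<tau>_def M_def flip_apply)
    qed
    fix p assume "p \<in> face c c \<times> face d l"
    then obtain a x where p: "p = (a, x)" and a: "a \<in> face c c" and x: "x \<in> face d l" by blast
    have \<tau>: "\<tau> (a, x) = (a, flip l x)" by (simp add: \<tau>_def)
    let ?A = "(nbhd d x \<union> nbhd d (flip l x)) \<inter> face d l"
    have A: "card W \<le> k" if "W \<subseteq> face c c \<times> ?A" for W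
    proof -
      have "card W \<le> 1 * (2 * (d - l)) - card ({} :: ((nat \<Rightarrow> nat) \<times> (nat \<Rightarrow> nat)) set)"
        using that card_nbhd_flip_face[OF x \<open>l < d\<close>]
        by (intro card_le_Times_Diff[of _ "face c c" ?A]) (simp_all add: face_full)
      then show ?thesis using \<open>2 * d \<le> k\<close> by simp
    qed
    show "card ((closed_nbhd Q p \<union> closed_nbhd Q (\<tau> p)) \<inter> face c c \<times> face d l - {p, \<tau> p}) \<le> k"
      unfolding p \<tau> cn[OF a x] cn[OF a fl(1)[OF x]] by (intro A) blast
    show "card (closed_nbhd Q p \<inter> face c c \<times> face d l - {p}) \<le> k \<or>
       black Q r p (\<tau> p) \<and> card (closed_nbhd Q p \<inter> face c c \<times> face d l - {p, \<tau> p}) \<le> k"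
      unfolding p cn[OF a x] by (intro disjI1 A) blast
  next
    let ?Z = "map_prod id (\<lambda>x. x(l := 0)) \<circ> r"
    have "weak_hom Q ?Z"
    proof (rule weak_hom_comp[OF r(1)])
      show "weak_hom Q (map_prod id (\<lambda>x. x(l := 0)))"
        unfolding Q_def by (rule weak_hom_cubes) (use zero_cube nbhd_zero \<open>l < d\<close> in auto)
    qed
    moreover have "?Z ` verts Q = face c c \<times> face d (Suc l)"
      unfolding image_comp[symmetric] r(2)
      by (rule map_prod_surj_on[OF id_image zero_image_face[OF \<open>l < d\<close>]])
    ultimately have "collapses k Q ?Z" by (rule step)
    moreover have "(if r p \<in> M then \<tau> (r p) else r p) = ?Z p" if "p \<in> verts Q" for p
    proof -
      have "r p \<in> face c c \<times> face d l" unfolding r(2)[symmetric] using that by (rule imageI)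
      then obtain a x where rp: "r p = (a, x)" "a \<in> face c c" "x \<in> face d l" by blast
      show ?thesis
      proof (cases "x l = 1")
        case True
        then have "r p \<in> M" using rp by (simp add: M_def)
        then show ?thesis using rp(1) True by (simp add: \<tau>_def flip_eq_zero)
      next
        case False
        then have "r p \<notin> M" "x(l := 0) = x"
          using rp(1) fl(3)[OF rp(3)] by (simp_all add: M_def fun_upd_idem)
        then show ?thesis using rp(1) by simp
      qed
    qed
    ultimately show "collapses k Q (\<lambda>p. if r p \<in> M then \<tau> (r p) else r p)"
      by (rule collapses_cong)
  qed
qed

lemma collapses_faces_snd:
  assumes "weak_hom (hypercube c \<boxtimes> hypercube d) r"
    and "r ` verts (hypercube c \<boxtimes> hypercube d) = face c c \<times> face d l" and "l \<le> d" "2 * d \<le> k"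
  shows "collapses k (hypercube c \<boxtimes> hypercube d) r"
  using assms(3,1,2)
proof (induction l arbitrary: r rule: inc_induct)
  case base
  then show ?case by (intro collapses.single) (simp add: face_full)
next
  case (step l)
  then show ?case using assms(4) by (intro collapses_zero_snd[of c d r l k]) auto
qed

lemma double_diff_le:
  fixes m n :: nat
  shows "m \<le> n \<Longrightarrow> 2 * m - 2 \<le> 2 * (n - 1)"
  by simp

text \<open>For \<open>j \<ge> 2\<close> an unmerged vertex has at most \<open>c - 1\<close> first
  coordinates to choose from, so the colour-blind alternative of \<open>single\<close> holds in
  every round.\<close>

lemma collapses_faces_fst:
  assumes "weak_hom (hypercube c \<boxtimes> hypercube d) r"
    and "r ` verts (hypercube c \<boxtimes> hypercube d) = face c j \<times> cube d" and "2 \<le> j" "j \<le> c"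
  shows "collapses (2 * ((c - 1) * (d + 1) - 1)) (hypercube c \<boxtimes> hypercube d) r"
  using assms(4,1-3)
proof (induction j arbitrary: r rule: inc_induct)
  case base
  \<comment> \<open>At \<open>j = c\<close> only the second factor remains, and this inequality
    yields the bound \<open>2 * d\<close> for its rounds.\<close>
  have "1 * (d + 1) \<le> (c - 1) * (d + 1)" using base by (intro mult_le_mono1) simp
  then show ?case using base by (intro collapses_faces_snd[of c d r 0]) auto
next
  case (step j)
  let ?k = "2 * ((c - 1) * (d + 1) - 1)"
  have "(c - j + 1) * (d + 1) \<le> (c - 1) * (d + 1)"
    using step by (intro mult_le_mono1) simp
  then have "(c - j + 1) * (d + 1) - 1 \<le> ?k" by simp
  moreover have "(c - j) * (d + 1) \<le> (c - 1) * (d + 1)"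
    using step by (intro mult_le_mono1) simp
  then have "2 * (c - j) * (d + 1) - 2 \<le> ?k" unfolding mult.assoc by (rule double_diff_le)
  ultimately show ?case using step by (intro collapses_zero_fst[of c d r j]) auto
qed

section \<open>Folding the 4-cycle of the first two coordinates\<close>

text \<open>The antipodal map of the 4-cycle spanned by coordinates 0 and 1.\<close>

definition antipode :: "(nat \<Rightarrow> nat) \<Rightarrow> nat \<Rightarrow> nat" where
  "antipode a = flip 0 (flip 1 a)"

text \<open>Each antipodal pair is named by its member with coordinate 0 equal to 0, so the image is
  \<open>face c 1\<close> and the rounds can continue at \<open>j = 1\<close>.\<close>

definition fold_square :: "(nat \<Rightarrow> nat) \<Rightarrow> nat \<Rightarrow> nat" where
  "fold_square a = (if a 0 = 1 then antipode a else a)"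

lemma antipode_cube: "a \<in> cube c \<Longrightarrow> 2 \<le> c \<Longrightarrow> antipode a \<in> cube c"
  unfolding antipode_def by (intro flip_cube) auto

lemma antipode_antipode: "a \<in> cube c \<Longrightarrow> 2 \<le> c \<Longrightarrow> antipode (antipode a) = a"
  unfolding antipode_def flip_commute[of 1 0 "flip 1 a"] by (simp add: flip_flip)

lemma antipode_flip: "antipode (flip i a) = flip i (antipode a)"
  unfolding antipode_def by (metis flip_commute)

text \<open>The two neighbours of \<open>a\<close> inside its 4-cycle are antipodes of each other,
  so merging antipodes creates no red edges towards them.\<close>

lemma antipode_flip_01:
  assumes "a \<in> cube c" "2 \<le> c"
  shows "antipode (flip 0 a) = flip 1 a" "antipode (flip 1 a) = flip 0 a"
proof -
  have "flip 1 a \<in> cube c" using assms by (intro flip_cube) auto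
  then show "antipode (flip 0 a) = flip 1 a" "antipode (flip 1 a) = flip 0 a"
    using assms unfolding antipode_def flip_commute[of 1 0 a] by (simp_all add: flip_flip)
qed

lemma antipode_nbhd: "b \<in> nbhd c a \<Longrightarrow> antipode b \<in> nbhd c (antipode a)"
  by (auto simp: nbhd_def antipode_flip)

lemma antipode_bit: "antipode a 0 = 1 - a 0"
  by (simp add: antipode_def flip_def)

lemma fold_square_face: "a \<in> cube c \<Longrightarrow> 2 \<le> c \<Longrightarrow> fold_square a \<in> face c 1"
  using antipode_cube[of a c] cube_bit[of a c 0]
  by (auto simp: fold_square_def face_def antipode_bit)

lemma fold_square_image:
  assumes "2 \<le> c"
  shows "fold_square ` cube c = face c 1"
proof
  show "fold_square ` cube c \<subseteq> face c 1" using fold_square_face assms by blast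
  show "face c 1 \<subseteq> fold_square ` cube c"
  proof
    fix a assume "a \<in> face c 1"
    then have "a = fold_square a" "a \<in> cube c" by (auto simp: face_def fold_square_def)
    then show "a \<in> fold_square ` cube c" by (metis imageI)
  qed
qed

lemma fold_square_nbhd:
  assumes a: "a \<in> cube c" and "2 \<le> c" and b: "b \<in> nbhd c a"
  shows "fold_square b \<in> nbhd c (fold_square a)"
proof -
  consider "b = a" | "b = flip 0 a" | i where "b = flip i a" "0 < i" "i < c"
    using b by (auto simp: nbhd_def)
  then show ?thesis
  proof cases
    case 2
    \<comment> \<open>Both flips of \<open>a\<close> inside the 4-cycle share one name, which in
      \<open>face c 1\<close> is reached by the flip at 1.\<close>
    have "fold_square b = flip 1 (fold_square a)"
    proof (cases "a 0 = 1")
      case True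
      then have "fold_square a = antipode a" "fold_square b = b"
        using 2 by (simp_all add: fold_square_def flip_apply)
      then show ?thesis
        using antipode_flip_01[OF assms(1,2)] antipode_flip[of 1 a] 2 by simp
    next
      case False
      then have "fold_square a = a" "fold_square b = antipode b"
        using 2 cube_bit[OF a, of 0] \<open>2 \<le> c\<close> by (auto simp: fold_square_def flip_apply)
      then show ?thesis
        using antipode_flip_01[OF assms(1,2)] 2 by simp
    qed
    then show ?thesis using \<open>2 \<le> c\<close> by (simp add: nbhd_def)
  next
    case 3
    then have "fold_square b = flip i (fold_square a)"
      by (simp add: fold_square_def antipode_flip flip_apply)
    then show ?thesis using 3 by (simp add: nbhd_def)
  qed simp
qed

lemma fold_square_fibre:
  assumes "a' \<in> cube c" "2 \<le> c" "fold_square a' = a"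
  shows "a' = a \<or> a' = antipode a"
  using assms antipode_antipode[of a' c] by (auto simp: fold_square_def split: if_splits)

text \<open>The two antipodal pairs of a 4-cycle are completely joined; this supplies the black edge
  in the round at coordinate 1.\<close>

lemma fold_square_fibres_adjacent:
  assumes a: "a \<in> cube c" and c: "2 \<le> c" and a': "a' \<in> cube c" "fold_square a' = a"
    and b': "b' \<in> cube c" "fold_square b' = flip 1 a"
  shows "b' \<in> nbhd c a' - {a'}"
proof -
  have "b' = flip 1 a \<or> b' = flip 0 a"
    using fold_square_fibre[OF b'(1) c b'(2)] antipode_flip_01[OF a c] by simp
  moreover have "a' = a \<or> a' = antipode a" using fold_square_fibre[OF a'(1) c a'(2)] .
  moreover have "flip 1 a = flip 0 (antipode a)" "flip 0 a = flip 1 (antipode a)"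
    using antipode_flip_01[OF a c] antipode_flip by metis+
  ultimately have "b' = flip 1 a' \<or> b' = flip 0 a'" by metis
  then show ?thesis using c by (auto simp: nbhd_def)
qed

text \<open>In the round \<open>j = 1\<close> the colour-blind count for an unmerged vertex is
  \<open>c * (d + 1) - 1\<close>, one too many when \<open>c = 2\<close>. Exempting the black
  partner saves that one.\<close>

lemma collapses_fold_square:
  fixes c d :: nat
  defines "Q \<equiv> hypercube c \<boxtimes> hypercube d"
  assumes "2 \<le> c"
  shows "collapses (2 * ((c - 1) * (d + 1) - 1)) Q (map_prod fold_square id)"
proof -
  let ?k = "2 * ((c - 1) * (d + 1) - 1)" and ?r = "map_prod fold_square id"
  have r: "weak_hom Q ?r"
    unfolding Q_def
  proof (rule weak_hom_cubes)
    show "fold_square a \<in> cube c" if "a \<in> cube c" for a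
      using fold_square_face[OF that \<open>2 \<le> c\<close>] face_subset by blast
  qed (use fold_square_nbhd \<open>2 \<le> c\<close> in simp_all)
  have im: "?r ` verts Q = face c 1 \<times> cube d"
    unfolding Q_def verts_strong_product verts_hypercube
    by (rule map_prod_surj_on[OF fold_square_image[OF \<open>2 \<le> c\<close>] id_image])
  have "black Q ?r (a, x) (flip 1 a, x)" if a: "a \<in> face c 1" and x: "x \<in> cube d" for a x
    unfolding black_def im
  proof (intro conjI ballI impI)
    have ac: "a \<in> cube c" using a face_subset by blast
    show "(a, x) \<noteq> (flip 1 a, x)" "(a, x) \<in> face c 1 \<times> cube d" using a x by simp_all
    show "(flip 1 a, x) \<in> face c 1 \<times> cube d" using flip_face[OF a] x \<open>2 \<le> c\<close> by simp
    fix p q assume "p \<in> verts Q" "q \<in> verts Q" "?r p = (a, x)" "?r q = (flip 1 a, x)"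
    then obtain a' b' where pq: "p = (a', x)" "q = (b', x)" "a' \<in> cube c" "b' \<in> cube c"
      "fold_square a' = a" "fold_square b' = flip 1 a" by (cases p; cases q) (simp add: Q_def)
    then have "b' \<in> nbhd c a' - {a'}" using fold_square_fibres_adjacent[OF ac \<open>2 \<le> c\<close>] by blast
    then show "adj Q p q" using pq x by (simp add: Q_def adj_cubes)
  qed
  moreover have "(c - 1 + 1) * (d + 1) - 2 \<le> ?k"
  proof -
    \<comment> \<open>Applied with \<open>n = (c - 1) * (d + 1)\<close> and
      \<open>m = d + 1\<close>, whose sum is \<open>c * (d + 1)\<close>.\<close>
    have "n + m - 2 \<le> 2 * (n - 1)" if "m \<le> n" for m n :: nat using that by simp
    moreover have "1 * (d + 1) \<le> (c - 1) * (d + 1)" using \<open>2 \<le> c\<close> by (intro mult_le_mono1) simp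
    ultimately show ?thesis unfolding distrib_right[of "c - 1"] by simp
  qed
  moreover have "2 * (c - 1) * (d + 1) - 2 \<le> ?k" unfolding mult.assoc by (rule double_diff_le) simp
  ultimately show ?thesis
    unfolding Q_def
    using r im \<open>2 \<le> c\<close> collapses_faces_fst[of c d _ 2]
    by (intro collapses_zero_fst[of c d ?r 1 ?k]) (auto simp: Q_def numeral_2_eq_2)
qed

lemma collapses_cubes:
  fixes c d :: nat
  defines "Q \<equiv> hypercube c \<boxtimes> hypercube d"
  assumes "2 \<le> c"
  shows "collapses (2 * ((c - 1) * (d + 1) - 1)) Q (\<lambda>p. p)"
proof -
  let ?\<sigma> = "map_prod antipode id" and ?M = "{p \<in> verts Q. fst p 0 = 1}"
  have V: "\<exists>a x. p = (a, x) \<and> a \<in> cube c \<and> x \<in> cube d" if "p \<in> verts Q" for p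
    using that by (cases p) (simp add: Q_def)
  show ?thesis
  proof (rule collapses_involution[of Q ?\<sigma> ?M])
    show "finite (verts Q)" by (simp add: Q_def)
    show "?M \<subseteq> verts Q" by blast
    fix p assume "p \<in> verts Q"
    then obtain a x where p: "p = (a, x)" and a: "a \<in> cube c" and x: "x \<in> cube d"
      using V by blast
    show "?\<sigma> p \<in> verts Q" "?\<sigma> (?\<sigma> p) = p"
      using p a x antipode_cube antipode_antipode \<open>2 \<le> c\<close> by (simp_all add: Q_def)
    show "p \<in> ?M \<longleftrightarrow> ?\<sigma> p \<notin> ?M"
      using p a x antipode_cube \<open>2 \<le> c\<close> cube_bit[OF a, of 0] by (auto simp: Q_def antipode_bit)
    let ?W = "{q \<in> verts Q. adj Q p q \<and> \<not> adj Q p (?\<sigma> q)}"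
    \<comment> \<open>The antipodes of \<open>flip 0 a\<close> and \<open>flip 1 a\<close> are again
      neighbours of \<open>a\<close>, so these two first coordinates drop out and
      \<open>c - 1\<close> remain.\<close>
    let ?A = "nbhd c a - {flip 0 a, flip 1 a}"
    have "?W \<subseteq> ?A \<times> nbhd d x - {(a, x)}"
    proof
      fix q assume q: "q \<in> ?W"
      then obtain b y where b: "q = (b, y)" "b \<in> nbhd c a" "y \<in> nbhd d x" "(b, y) \<noteq> (a, x)"
        using a x by (cases q) (simp add: p Q_def adj_cubes)
      have "antipode b \<in> nbhd c a - {a}" if "b \<in> {flip 0 a, flip 1 a}"
        using that antipode_flip_01[OF a \<open>2 \<le> c\<close>] \<open>2 \<le> c\<close> by (auto simp: nbhd_def)
      then have "b \<notin> {flip 0 a, flip 1 a}" using q b a x by (auto simp: p Q_def adj_cubes)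
      then show "q \<in> ?A \<times> nbhd d x - {(a, x)}" using b by simp
    qed
    moreover have "card ?A \<le> c - 1"
    proof -
      have "{flip 0 a, flip 1 a} \<subseteq> nbhd c a" using \<open>2 \<le> c\<close> by (auto simp: nbhd_def)
      then have "card ?A = c + 1 - card {flip 0 a, flip 1 a}"
        by (simp add: card_Diff_subset card_nbhd)
      then show ?thesis by simp
    qed
    ultimately have "card ?W \<le> (c - 1) * (d + 1) - card {(a, x)}"
      using card_nbhd[of d x] by (intro card_le_Times_Diff) auto
    then show "2 * card ?W \<le> 2 * ((c - 1) * (d + 1) - 1)" by simp
    fix q assume "q \<in> verts Q" "adj Q p q"
    then show "adj Q (?\<sigma> p) (?\<sigma> q)"
      using p a x antipode_cube[OF a \<open>2 \<le> c\<close>] antipode_nbhd antipode_antipode[OF _ \<open>2 \<le> c\<close>] V[of q]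
      by (auto simp: Q_def adj_cubes) metis
  next
    have "collapses (2 * ((c - 1) * (d + 1) - 1)) Q (map_prod fold_square id)"
      unfolding Q_def using \<open>2 \<le> c\<close> by (rule collapses_fold_square)
    then show "collapses (2 * ((c - 1) * (d + 1) - 1)) Q (\<lambda>p. if p \<in> ?M then ?\<sigma> p else p)"
      by (rule collapses_cong) (auto simp: fold_square_def split: prod.split)
  qed
qed

section \<open>Upper and lower bounds for the twin-width\<close>

lemma tww_cubes_le:
  assumes "2 \<le> c"
  shows "tww (hypercube c \<boxtimes> hypercube d) \<le> 2 * ((c - 1) * (d + 1) - 1)"
  by (rule tww_le[OF collapses_cubes[OF assms] is_graph_cubes _ is_graph_cubes])
    (simp_all add: bij_betw_def)

lemma tww_cubes_le_swap:
  assumes "2 \<le> d"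
  shows "tww (hypercube c \<boxtimes> hypercube d) \<le> 2 * ((d - 1) * (c + 1) - 1)"
proof (rule tww_le)
  let ?Q = "hypercube d \<boxtimes> hypercube c"
  show "collapses (2 * ((d - 1) * (c + 1) - 1)) ?Q (prod.swap \<circ> (\<lambda>p. p))"
    by (rule collapses_relabel[OF collapses_cubes[OF assms]]) simp_all
  show "bij_betw (prod.swap \<circ> (\<lambda>p. p)) (verts ?Q) (verts (hypercube c \<boxtimes> hypercube d))"
    by (simp add: bij_betw_def product_swap comp_def)
  show "adj (hypercube c \<boxtimes> hypercube d) ((prod.swap \<circ> (\<lambda>p. p)) p) ((prod.swap \<circ> (\<lambda>p. p)) q) \<longleftrightarrow>
      adj ?Q p q" for p q
    by (cases p; cases q) (auto simp: adj_cubes)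
qed (rule is_graph_cubes)+

text \<open>The closed neighbourhoods are boxes of equal size. If the first coordinates differ, the
  boxes share at most \<open>2 * (d + 1)\<close> vertices, otherwise at most
  \<open>(c + 1) * 2\<close>.\<close>

lemma card_sym_diff_cubes:
  fixes c d :: nat
  defines "Q \<equiv> hypercube c \<boxtimes> hypercube d"
  assumes "p \<in> verts Q" "q \<in> verts Q" "p \<noteq> q"
  shows "min (2 * ((c - 1) * (d + 1))) (2 * ((d - 1) * (c + 1))) - 2
    \<le> card (sym_diff (closed_nbhd Q p) (closed_nbhd Q q) - {p, q})"
proof -
  obtain a x b y where p: "p = (a, x)" "a \<in> cube c" "x \<in> cube d"
    and q: "q = (b, y)" "b \<in> cube c" "y \<in> cube d"
    using assms(2,3) unfolding Q_def by (cases p; cases q) simp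
  define A where "A = nbhd c a \<times> nbhd d x"
  define B where "B = nbhd c b \<times> nbhd d y"
  have AB: "closed_nbhd Q p = A" "closed_nbhd Q q = B"
    unfolding Q_def A_def B_def using p q by (simp_all add: closed_nbhd_cubes)
  have fin: "finite A" "finite B" by (simp_all add: A_def B_def)
  have card: "card A = (c + 1) * (d + 1)" "card B = (c + 1) * (d + 1)"
    by (simp_all only: A_def B_def card_cartesian_product card_nbhd)
  have I: "card (A \<inter> B) = card (nbhd c a \<inter> nbhd c b) * card (nbhd d x \<inter> nbhd d y)"
    by (simp add: A_def B_def Times_Int_Times card_cartesian_product)
  have le: "card (nbhd n e \<inter> nbhd n f) \<le> n + 1" for n e f
    using card_mono[of "nbhd n e" "nbhd n e \<inter> nbhd n f"] card_nbhd[of n e] by simp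
  have I_le: "card (A \<inter> B) \<le> 2 * (d + 1) \<or> card (A \<inter> B) \<le> 2 * (c + 1)"
  proof (cases "a = b")
    case True
    then have "x \<noteq> y" using p q assms(4) by simp
    then have "card (A \<inter> B) \<le> (c + 1) * 2"
      unfolding I using le card_nbhd_Int[OF p(3) q(3)] by (intro mult_le_mono)
    then show ?thesis by simp
  next
    case False
    then have "card (A \<inter> B) \<le> 2 * (d + 1)"
      unfolding I using le card_nbhd_Int[OF p(2) q(2)] by (intro mult_le_mono)
    then show ?thesis by simp
  qed
  have m: "(c - 1) * (d + 1) = card A - 2 * (d + 1)"
    unfolding card diff_mult_distrib[symmetric] by simp
  have n: "(d - 1) * (c + 1) = card A - 2 * (c + 1)"
    unfolding card mult.commute[of "c + 1" "d + 1"] diff_mult_distrib[symmetric] by simp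
  \<comment> \<open>Here \<open>n\<close> is the size of a box, \<open>k\<close> that of the
    intersection, and \<open>i\<close>, \<open>j\<close> are its two possible bounds.\<close>
  have "min (2 * (n - i)) (2 * (n - j)) \<le> (n - k) + (n - k)" if "k \<le> i \<or> k \<le> j"
    for i j k n :: nat using that by auto
  from this[OF I_le] have "min (2 * ((c - 1) * (d + 1))) (2 * ((d - 1) * (c + 1)))
      \<le> (card A - card (A \<inter> B)) + (card B - card (A \<inter> B))"
    unfolding m n card .
  also have "\<dots> = card (A - B) + card (B - A)"
    using fin by (simp add: card_Diff_subset_Int Int_commute)
  also have "\<dots> = card (sym_diff A B)"
    using fin by (intro card_Un_disjoint[symmetric]) auto
  \<comment> \<open>Both \<open>p\<close> and \<open>q\<close> may lie in the symmetric difference,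
    which accounts for the final 2.\<close>
  also have "card (sym_diff A B) \<le> card (sym_diff A B - {p, q}) + 2"
    using diff_card_le_card_Diff[of "{p, q}" "sym_diff A B"] assms(4) by simp
  finally show ?thesis unfolding AB by (simp only: le_diff_conv)
qed

lemma tww_cubes_ge:
  assumes "2 \<le> c"
  shows "min (2 * ((c - 1) * (d + 1))) (2 * ((d - 1) * (c + 1))) - 2 \<le> tww (hypercube c \<boxtimes> hypercube d)"
proof (rule tww_ge)
  let ?Q = "hypercube c \<boxtimes> hypercube d"
  \<comment> \<open>The sequence behind the upper bound shows that some sequence exists at
    all.\<close>
  show "\<exists>S. is_d_sequence (2 * ((c - 1) * (d + 1) - 1)) ?Q S"
    using is_d_sequence_exists[OF collapses_cubes[OF assms] is_graph_cubes _ is_graph_cubes]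
    by (simp add: bij_betw_def)
  show "is_graph ?Q" by (rule is_graph_cubes)
  have "card (verts ?Q) = 2 ^ c * 2 ^ d"
    by (simp add: card_cartesian_product cube_def card_PiE numeral_2_eq_2)
  moreover have "(2::nat) ^ 1 * 1 \<le> 2 ^ c * 2 ^ d"
    using assms by (intro mult_le_mono power_increasing) auto
  ultimately show "2 \<le> card (verts ?Q)" by simp
qed (rule card_sym_diff_cubes)

theorem proposition3p9:
  fixes c d :: nat
  assumes "c \<ge> 2" and "d \<ge> 2"
  shows "int (tww (hypercube c \<boxtimes> hypercube d)) =
    2 * int c * int d + 2 * min (int c - int d) (int d - int c) - 4"
proof -
  let ?m = "(c - 1) * (d + 1)" and ?n = "(d - 1) * (c + 1)"
  have "tww (hypercube c \<boxtimes> hypercube d) = min (2 * ?m) (2 * ?n) - 2"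
    using tww_cubes_le[OF assms(1), of d] tww_cubes_le_swap[OF assms(2), of c]
      tww_cubes_ge[OF assms(1), of d] unfolding diff_mult_distrib2 min_def by (simp split: if_splits)
  \<comment> \<open>Positivity of both products makes the truncated subtraction agree with the
    integer one.\<close>
  moreover have "1 * 1 \<le> ?m" "1 * 1 \<le> ?n"
    using assms by (intro mult_le_mono; simp)+
  ultimately have tww: "int (tww (hypercube c \<boxtimes> hypercube d)) = min (2 * int ?m) (2 * int ?n) - 2"
    by linarith
  have "1 \<le> c" "1 \<le> d" using assms by simp_all
  then have "int ?m = (int c - 1) * (int d + 1)" "int ?n = (int d - 1) * (int c + 1)"
    by (simp_all only: of_nat_mult of_nat_add of_nat_diff of_nat_1)
  \<comment> \<open>Twice the two products expand to \<open>2 * c * d + 2 * (c - d) - 2\<close> and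
    \<open>2 * c * d + 2 * (d - c) - 2\<close> over the integers.\<close>
  then show ?thesis unfolding tww by (simp only:) (simp add: min_def algebra_simps)
qed

end
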